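(* The class $\mathcal{KP}$ of all finite ordered polyhedra has the Ramsey property: for every integer $r>1$ and all $\mathbb A,\mathbb B\in\mathcal{KP}$ with $\mathbb A\leq\mathbb B$, there is $\mathbb C\in\mathcal{KP}$ such that for every $r$-coloring $c:\binom{\mathbb C}{\mathbb A}\to r$ there exists $\mathbb B'\in\binom{\mathbb C}{\mathbb B}$ for which $\binom{\mathbb B'}{\mathbb A}$ is monochromatic.
   Context: Let $L=\langle (R_i)_{i\in\mathbb N\setminus\{0\}}\rangle$ be a signature with $R_i$ a relation symbol of arity $i$. A polyhedron is a countable $L$-structure $\mathbb A=\langle A,(R_i^{\mathbb A})_i\rangle$ such that, for $\{a_1,\dots,a_i\}\subseteq A$ (distinct elements), $(a_1,\dots,a_i)\in R_i^{\mathbb A}$ iff $(a_{\sigma(1)},\dots,a_{\sigma(i)})\in R_i^{\mathbb A}$ for every permutation $\sigma$, and $(a_1,\dots,a_i)\in R_i^{\mathbb A}$ implies $(a_{j_1},\dots,a_{j_k})\in R_k^{\mathbb A}$ for every $k\leq i$ and every subset $\{a_{j_1},\dots,a_{j_k}\}$. Relations hold only of tuples of distinct elements and every vertex satisfies $R_1$; thus a polyhedron is the same as a pair $(A,S_A)$ with $A$ countable, $S_A$ a hereditary family of finite subsets of $A$ with $\bigcup S_A=A$, where $(a_1,\dots,a_i)\in R_i$ iff $\{a_1,\dots,a_i\}\in S_A$. An ordered polyhedron is an $L\cup\{<\}$-structure consisting of a polyhedron with a total ordering of its vertex set. $\mathcal{KP}$ is the class of finite ordered polyhedra. $\mathbb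 A\leq\mathbb B$ means $\mathbb A$ is a substructure of $\mathbb B$ (induced relations and order), and $\binom{\mathbb B}{\mathbb A}$ is the set of substructures of $\mathbb B$ isomorphic to $\mathbb A$. *)

theory Defs
  imports Main "HOL-Library.Countable_Set" "HOL-Library.FuncSet" "HOL-Combinatorics.Permutations"
begin

record 'a L_structure =
  univ :: "'a set"
  rel :: "nat \<Rightarrow> 'a list set"

record 'a ordered_L_structure = "'a L_structure" +
  less_rel :: "('a \<times> 'a) set"

text \<open>
  \<open>rel M i\<close> interprets the symbol \<open>R\<^sub>i\<close>, a tuple being a list. The signature has no
  symbol of arity \<open>0\<close>, so the slot \<open>rel M 0\<close> is fixed to be empty. Together with the fact that
  all components live on the universe only, this makes equality of records coincide with equality
  of structures, which matters when substructures are coloured.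
\<close>

definition is_L_structure :: "('a, 'b) L_structure_scheme \<Rightarrow> bool" where
  "is_L_structure M \<longleftrightarrow>
     (\<forall>i. rel M i \<subseteq> {xs. length xs = i \<and> set xs \<subseteq> univ M}) \<and> rel M 0 = {}"

definition polyhedron :: "('a, 'b) L_structure_scheme \<Rightarrow> bool" where
  "polyhedron M \<longleftrightarrow>
     is_L_structure M \<and>
     countable (univ M) \<and>
     (\<forall>i. \<forall>xs \<in> rel M i. distinct xs) \<and>
     (\<forall>a \<in> univ M. [a] \<in> rel M 1) \<and>
     (\<forall>i xs \<sigma>. length xs = i \<and> set xs \<subseteq> univ M \<and> distinct xs \<and> \<sigma> permutes {..<i} \<longrightarrow>
        (xs \<in> rel M i \<longleftrightarrow> permute_list \<sigma> xs \<in> rel M i)) \<and>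
     (\<forall>i k xs ys. xs \<in> rel M i \<and> 1 \<le> k \<and> k \<le> i \<and>
        length ys = k \<and> distinct ys \<and> set ys \<subseteq> set xs \<longrightarrow> ys \<in> rel M k)"

definition ordered_polyhedron :: "'a ordered_L_structure \<Rightarrow> bool" where
  "ordered_polyhedron M \<longleftrightarrow>
     polyhedron M \<and>
     less_rel M \<subseteq> univ M \<times> univ M \<and>
     irrefl (less_rel M) \<and> trans (less_rel M) \<and> total_on (univ M) (less_rel M)"

definition KP :: "'a ordered_L_structure set" where
  "KP = {M. ordered_polyhedron M \<and> finite (univ M)}"

definition substructure :: "'a ordered_L_structure \<Rightarrow> 'a ordered_L_structure \<Rightarrow> bool" where
  "substructure M N \<longleftrightarrow>
     univ M \<subseteq> univ N \<and>
     (\<forall>i. rel M i = {xs \<in> rel N i. set xs \<subseteq> univ M}) \<and>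
     less_rel M = less_rel N \<inter> (univ M \<times> univ M)"

definition isomorphic :: "'a ordered_L_structure \<Rightarrow> 'b ordered_L_structure \<Rightarrow> bool" where
  "isomorphic M N \<longleftrightarrow>
     (\<exists>f. bij_betw f (univ M) (univ N) \<and>
        (\<forall>i xs. length xs = i \<and> set xs \<subseteq> univ M \<longrightarrow> (xs \<in> rel M i \<longleftrightarrow> map f xs \<in> rel N i)) \<and>
        (\<forall>x \<in> univ M. \<forall>y \<in> univ M. (x, y) \<in> less_rel M \<longleftrightarrow> (f x, f y) \<in> less_rel N))"

definition copies :: "'b ordered_L_structure \<Rightarrow> 'a ordered_L_structure \<Rightarrow> 'b ordered_L_structure set" where
  "copies N M = {M'. substructure M' N \<and> isomorphic M' M}"

definition monochromatic :: "('x \<Rightarrow> nat) \<Rightarrow> 'x set \<Rightarrow> bool" where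
  "monochromatic c X \<longleftrightarrow> (\<exists>k. \<forall>x \<in> X. c x = k)"

end

theory Submission
  imports Defs "HOL-Library.Nat_Bijection"
begin

text \<open>
  An ordered polyhedron is the nerve of the family of its vertex stars, so it embeds in the polyhedron
  \<open>C\<close> of all nonempty subsets of \<open>{..<N}\<close>, where a family of subsets is a simplex iff it has a common
  point and the subsets are ordered by their least elements. A word of length \<open>N\<close> whose letters are
  the faces of \<open>M\<close> (including the empty one) gives such an embedding, mapping a vertex to the set of
  positions whose letter contains it, as soon as every nonempty face occurs and the singletons first
  occur in the order of the vertices. Enumerating the faces in the colexicographic order, it suffices
  that all nonempty faces first occur in this order, i.e. that the word is a parameter word. An
  embedding of \<open>A\<close> into \<open>B\<close> turns faces of \<open>B\<close> into faces of \<open>A\<close> by taking preimages, and since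
  the colexicographic order extends inclusion and is respected by order-preserving maps, this is
  again a parameter word. Hence composing embeddings is substitution of parameter words, and the
  theorem follows from the Graham-Rothschild theorem with one constant letter, the empty face.
\<close>

section \<open>Parameter words and the Hales-Jewett theorem\<close>

text \<open>
  In a parameter word the letters below \<open>a\<close> are constants, and the letters \<open>a, \<dots>, k - 1\<close>
  are parameters, each of which occurs, in the order of their first occurrences.
\<close>

fun rigid :: "nat \<Rightarrow> nat \<Rightarrow> nat list \<Rightarrow> bool" where
  "rigid a k [] \<longleftrightarrow> a = k"
| "rigid a k (x # w) \<longleftrightarrow> (if x < a then rigid a k w else x = a \<and> rigid (Suc a) k w)"

section \<open>Parameter words and their composition\<close>

definition words :: "nat \<Rightarrow> nat \<Rightarrow> nat \<Rightarrow> nat list set" where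
  "words a k n = {w. rigid a k w \<and> length w = n}"

text \<open>Composition of parameter words: a letter of \<open>f\<close> from \<open>a\<close> on is
  a parameter and points to a position of \<open>g\<close>.\<close>

definition subst :: "nat \<Rightarrow> nat list \<Rightarrow> nat list \<Rightarrow> nat list" where
  "subst a g f = map (\<lambda>x. if x < a then x else g ! (x - a)) f"

text \<open>Frees the letter \<open>a\<close> by renaming the parameters. The result can be read as
  a word over one more constant that does not occur in it, or be appended to a block whose only
  parameter is \<open>a\<close>.\<close>

definition shift :: "nat \<Rightarrow> nat list \<Rightarrow> nat list" where
  "shift a w = map (\<lambda>x. if x < a then x else Suc x) w"

lemma rigid_le: "rigid a k w \<Longrightarrow> a \<le> k"
  by (induction a k w rule: rigid.induct) (auto split: if_splits)

lemma rigid_set: "rigid a k w \<Longrightarrow> set w \<subseteq> {..<k}"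
proof (induction a k w rule: rigid.induct)
  case (2 a k x w)
  then show ?case by (auto split: if_splits dest: rigid_le)
qed auto

lemma rigid_first:
  "rigid a k w \<Longrightarrow> a \<le> i \<Longrightarrow> i < k \<Longrightarrow> \<exists>p<length w. w ! p = i \<and> (\<forall>q<p. w ! q < i)"
proof (induction a k w rule: rigid.induct)
  case (2 a k x w)
  show ?case
  proof (cases "x = i")
    case True
    then show ?thesis by (intro exI[of _ 0]) auto
  next
    case False
    then have "x < i" "\<exists>p<length w. w ! p = i \<and> (\<forall>q<p. w ! q < i)"
      using 2 by (auto split: if_splits)
    then obtain p where "p < length w" "w ! p = i" "\<forall>q<p. w ! q < i" by blast
    with \<open>x < i\<close> show ?thesis
      by (intro exI[of _ "Suc p"]) (auto simp: less_Suc_eq_0_disj)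
  qed
qed auto

text \<open>Converse of \<open>rigid_set\<close> and \<open>rigid_first\<close>, so that parameter
  words can be recognised by first occurrences. The head cannot exceed \<open>a\<close>, since only
  letters below \<open>a\<close> precede the first \<open>a\<close>.\<close>

lemma rigidI:
  assumes "a \<le> k" "set w \<subseteq> {..<k}"
    and "\<And>i. a \<le> i \<Longrightarrow> i < k \<Longrightarrow> \<exists>p<length w. w ! p = i \<and> (\<forall>q<p. w ! q < i)"
  shows "rigid a k w"
  using assms
proof (induction w arbitrary: a)
  case Nil
  have "\<not> a < k" using Nil(3)[of a] by auto
  then show ?case using Nil(1) by simp
next
  case (Cons x w)
  have tail: "\<exists>p<length w. w ! p = i \<and> (\<forall>q<p. w ! q < i)" if "a \<le> i" "i < k" "x \<noteq> i" for i
  proof -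
    obtain p where p: "p < length (x # w)" "(x # w) ! p = i" "\<forall>q<p. (x # w) ! q < i"
      using Cons.prems(3)[OF \<open>a \<le> i\<close> \<open>i < k\<close>] by blast
    then obtain p' where "p = Suc p'" using \<open>x \<noteq> i\<close> by (cases p) auto
    moreover have "w ! q < i" if "q < p'" for q
      using p(3) that \<open>p = Suc p'\<close> by (metis Suc_less_eq nth_Cons_Suc)
    ultimately show ?thesis using p by (intro exI[of _ p']) auto
  qed
  have x: "x < a \<or> x = a"
  proof (rule ccontr)
    assume "\<not> (x < a \<or> x = a)"
    then have "a < x" "a < k" using Cons.prems(2) by auto
    then obtain p where "p < length (x # w)" "(x # w) ! p = a" "\<forall>q<p. (x # w) ! q < a"
      using Cons.prems(3)[of a] by blast
    then show False using \<open>a < x\<close> by (cases p) auto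
  qed
  show ?case
  proof (cases "x < a")
    case True
    then show ?thesis using Cons.IH[of a] Cons.prems tail by auto
  next
    case False
    with x have "x = a" by simp
    moreover have "rigid (Suc a) k w"
      using Cons.prems \<open>x = a\<close> tail by (intro Cons.IH) auto
    ultimately show ?thesis by simp
  qed
qed

lemma rigid_same_iff: "rigid a a w \<longleftrightarrow> set w \<subseteq> {..<a}"
  by (meson le_refl not_le rigidI rigid_set)

lemma rigid_append: "rigid a j u \<Longrightarrow> rigid j k v \<Longrightarrow> rigid a k (u @ v)"
  by (induction a j u rule: rigid.induct) auto

lemma length_subst [simp]: "length (subst a g f) = length f"
  by (simp add: subst_def)

lemma length_shift [simp]: "length (shift a f) = length f"
  by (simp add: shift_def)

text \<open>If \<open>i\<close> first occurs in \<open>g\<close> at \<open>p\<close>, it first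
  occurs in the composite where \<open>f\<close> first uses the parameter \<open>a + p\<close>:
  before that, \<open>f\<close> has only constants and earlier parameters, all sent below
  \<open>i\<close>.\<close>

lemma rigid_subst:
  assumes "rigid a (a + length g) f" "rigid a k g"
  shows "rigid a k (subst a g f)"
proof (rule rigidI)
  show "a \<le> k" using assms rigid_le by blast
  show "set (subst a g f) \<subseteq> {..<k}"
  proof
    fix y assume "y \<in> set (subst a g f)"
    then obtain x where x: "x \<in> set f" "y = (if x < a then x else g ! (x - a))"
      by (auto simp: subst_def)
    moreover have "x < a + length g" using x(1) rigid_set[OF assms(1)] by auto
    then have "\<not> x < a \<Longrightarrow> g ! (x - a) \<in> set g" by simp
    ultimately show "y \<in> {..<k}" using rigid_set[OF assms(2)] \<open>a \<le> k\<close> by auto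
  qed
  fix i assume i: "a \<le> i" "i < k"
  obtain p where p: "p < length g" "g ! p = i" "\<forall>q<p. g ! q < i"
    using rigid_first[OF assms(2) i] by blast
  obtain q where q: "q < length f" "f ! q = a + p" "\<forall>t<q. f ! t < a + p"
    using rigid_first[OF assms(1), of "a + p"] p(1) by auto
  show "\<exists>p<length (subst a g f). subst a g f ! p = i \<and> (\<forall>q<p. subst a g f ! q < i)"
  proof (intro exI[of _ q] conjI allI impI)
    show "q < length (subst a g f)" "subst a g f ! q = i"
      using p q by (auto simp: subst_def)
    fix t assume "t < q"
    then have "f ! t < a \<or> f ! t - a < p" "t < length f" using q by (auto simp: less_diff_conv2)
    then show "subst a g f ! t < i" using p i by (auto simp: subst_def)
  qed
qed

text \<open>Associativity of composition; the bound keeps the letters of \<open>f\<close> from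
  pointing beyond the end of \<open>g\<close>.\<close>

lemma subst_subst:
  assumes "set f \<subseteq> {..<a + length g}"
  shows "subst a h (subst a g f) = subst a (subst a h g) f"
  using assms by (auto simp: subst_def nth_map subset_iff)

lemma rigid_shift: "rigid a k w \<Longrightarrow> b \<le> a \<Longrightarrow> rigid (Suc a) (Suc k) (shift b w)"
  by (induction a k w rule: rigid.induct) (auto simp: shift_def split: if_splits)

text \<open>The letter \<open>a\<close> is absent from \<open>shift a f\<close>, so \<open>x\<close>
  is never read, and every parameter points one place further.\<close>

lemma subst_shift_Cons: "subst a (x # g) (shift a f) = subst a g f"
  by (auto simp: subst_def shift_def Suc_diff_le)

lemma words_subst: "f \<in> words a (a + m) n \<Longrightarrow> g \<in> words a k m \<Longrightarrow> subst a g f \<in> words a k n"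
  by (auto simp: words_def rigid_subst)

lemma words_subst_subst:
  assumes "f \<in> words a (a + m) n" "length g = m"
  shows "subst a h (subst a g f) = subst a (subst a h g) f"
  using assms rigid_set by (intro subst_subst) (auto simp: words_def)

lemma words_shift: "w \<in> words a k n \<Longrightarrow> shift a w \<in> words (Suc a) (Suc k) n"
  by (simp add: words_def rigid_shift)

lemma words_same: "words a a n = {w. set w \<subseteq> {..<a} \<and> length w = n}"
  by (simp add: words_def rigid_same_iff)

lemma finite_words: "finite (words a k n)"
  by (rule finite_subset[OF _ finite_lists_length_eq[of "{..<k}" n]])
    (auto simp: words_def dest: rigid_set)

text \<open>Lets a list of colours of fixed length serve as one colour, so that a colouring can
  record the colours of several words at once.\<close>

lemma list_encode_bound:
  "\<exists>R. \<forall>xs. length xs = n \<and> set xs \<subseteq> {..<r} \<longrightarrow> list_encode xs < (R::nat)"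
proof -
  have "finite (list_encode ` {xs. set xs \<subseteq> {..<r} \<and> length xs = n})"
    by (intro finite_imageI finite_lists_length_eq) simp
  then obtain R where "\<forall>y\<in>list_encode ` {xs. set xs \<subseteq> {..<r} \<and> length xs = n}. y < R"
    using finite_nat_set_iff_bounded by blast
  then show ?thesis by (intro exI[of _ R]) auto
qed

text \<open>
  The Graham-Rothschild property for \<open>k - a\<close> parameters inside \<open>m\<close> parameters over \<open>a\<close> constants;
  the Hales-Jewett theorem is the case \<open>k = a\<close>.
\<close>

definition GR :: "nat \<Rightarrow> nat \<Rightarrow> nat \<Rightarrow> nat \<Rightarrow> bool" where
  "GR a k m r \<longleftrightarrow>
     (\<exists>N. \<forall>c. (\<forall>w. c w < r) \<longrightarrow>
        (\<exists>f\<in>words a (a + m) N. \<exists>t. \<forall>g\<in>words a k m. c (subst a g f) = t))"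

text \<open>
  Hales-Jewett by Shelah's argument: on a suitable parameter word a colouring does not distinguish the
  last letter \<open>a\<close> from \<open>0\<close>, which reduces the alphabet by one letter.
\<close>

definition merge_last :: "nat \<Rightarrow> nat list \<Rightarrow> nat list" where
  "merge_last a u = map (\<lambda>x. if x = a then 0 else x) u"

text \<open>Pigeonhole on the \<open>M + 1\<close> words \<open>w p\<close>: two of them, for
  \<open>p < q\<close>, have the same value. A parameter on the positions from \<open>p\<close> up
  to \<open>q\<close> gives back \<open>w p\<close> when set to \<open>a\<close> and
  \<open>w q\<close> when set to \<open>0\<close>. The lists \<open>u\<close> and \<open>v\<close>
  are arbitrary because \<open>b\<close> has no other parameter.\<close>

lemma shelah_block:
  assumes "\<And>w. w \<in> words (Suc a) (Suc a) M \<Longrightarrow> c w \<in> X" "finite X" "card X \<le> M"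
  shows "\<exists>b\<in>words (Suc a) (Suc (Suc a)) M. \<forall>u v.
           c (subst (Suc a) (a # u) b) = c (subst (Suc a) (0 # v) b)"
proof -
  define w where "w p = replicate p 0 @ replicate (M - p) a" for p
  have w: "w p \<in> words (Suc a) (Suc a) M" if "p \<le> M" for p
    using that by (auto simp: w_def words_same)
  have "\<not> inj_on (c \<circ> w) {..M}"
  proof
    assume inj: "inj_on (c \<circ> w) {..M}"
    have "card {..M} \<le> card X"
      by (rule card_inj_on_le[OF inj]) (use assms w in auto)
    then show False using assms(3) by simp
  qed
  then obtain p q where pq: "p < q" "q \<le> M" "c (w p) = c (w q)"
    unfolding inj_on_def by (metis atMost_iff comp_apply linorder_neqE_nat)
  define b where "b = replicate p 0 @ replicate (q - p) (Suc a) @ replicate (M - q) a"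
  have R1: "rigid (Suc a) (Suc a) (replicate p 0)" "rigid (Suc (Suc a)) (Suc (Suc a)) (replicate (q - Suc p) (Suc a) @ replicate (M - q) a)"
    by (auto simp: rigid_same_iff)
  have "b = replicate p 0 @ Suc a # (replicate (q - Suc p) (Suc a) @ replicate (M - q) a)"
    using pq(1) unfolding b_def by (metis Suc_diff_Suc append_Cons replicate_Suc)
  then have "rigid (Suc a) (Suc (Suc a)) b"
    using rigid_append[OF R1(1), of "Suc (Suc a)"] R1(2) by simp
  moreover have "length b = M" using pq by (simp add: b_def)
  moreover have "subst (Suc a) (a # u) b = w p" for u
  proof -
    have "subst (Suc a) (a # u) b = replicate p 0 @ replicate (q - p) a @ replicate (M - q) a"
      by (simp add: b_def subst_def)
    also have "\<dots> = w p" using pq by (simp add: w_def flip: replicate_add)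
    finally show ?thesis .
  qed
  moreover have "subst (Suc a) (0 # v) b = w q" for v
  proof -
    have "subst (Suc a) (0 # v) b = (replicate p 0 @ replicate (q - p) 0) @ replicate (M - q) a"
      by (simp add: b_def subst_def)
    also have "replicate p 0 @ replicate (q - p) 0 = replicate q (0::nat)"
      using pq by (simp flip: replicate_add)
    finally show ?thesis by (simp add: w_def)
  qed
  ultimately show ?thesis using pq by (auto simp: words_def)
qed

text \<open>Induction on \<open>n\<close>: a block with one parameter is put in front of a word with
  \<open>n\<close> parameters. The tail is chosen first, for a colouring that records the effect of
  all blocks, then the block, for one that records the effect of all tails. The colour survives
  merging in the tail and then in the block.\<close>

lemma shelah:
  "\<exists>N. \<forall>c. (\<forall>w. c w < (r::nat)) \<longrightarrow>
     (\<exists>f\<in>words (Suc a) (Suc a + n) N. \<forall>u\<in>words (Suc a) (Suc a) n.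
        c (subst (Suc a) u f) = c (subst (Suc a) (merge_last a u) f))"
proof (induction n arbitrary: r)
  case 0
  show ?case by (intro exI[of _ 0] allI impI bexI[of _ "[]"]) (auto simp: words_def subst_def)
next
  case (Suc n)
  obtain us where us: "set us = words (Suc a) (Suc a) n"
    using finite_list[OF finite_words] by blast
  \<comment> \<open>The colour vectors indexed by all words to be put into the tail. Their number
    fixes the block length \<open>M\<close> before the tail length \<open>N\<close> is
    determined.\<close>
  define X where "X = {xs. set xs \<subseteq> {..<r} \<and> length xs = length us}"
  define M where "M = card X"
  obtain bs where bs: "set bs = words (Suc a) (Suc a) M"
    using finite_list[OF finite_words] by blast
  obtain R where R: "\<And>xs. length xs = length bs \<Longrightarrow> set xs \<subseteq> {..<r} \<Longrightarrow> list_encode xs < R"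
    using list_encode_bound[of "length bs" r] by blast
  obtain N where N: "\<And>c. (\<forall>w. c w < R) \<Longrightarrow>
     (\<exists>f\<in>words (Suc a) (Suc a + n) N. \<forall>u\<in>words (Suc a) (Suc a) n.
        c (subst (Suc a) u f) = c (subst (Suc a) (merge_last a u) f))"
    using Suc.IH[of R] by blast
  show ?case
  proof (intro exI[of _ "M + N"] allI impI)
    fix c :: "nat list \<Rightarrow> nat" assume c: "\<forall>w. c w < r"
    have "\<forall>w. list_encode (map (\<lambda>b. c (b @ w)) bs) < R"
      using c by (auto intro!: R)
    from N[OF this] obtain f where f: "f \<in> words (Suc a) (Suc a + n) N"
      and "\<forall>u\<in>words (Suc a) (Suc a) n.
        list_encode (map (\<lambda>b. c (b @ subst (Suc a) u f)) bs)
          = list_encode (map (\<lambda>b. c (b @ subst (Suc a) (merge_last a u) f)) bs)"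
      by blast
    then have tail: "c (b @ subst (Suc a) u f) = c (b @ subst (Suc a) (merge_last a u) f)"
      if "u \<in> words (Suc a) (Suc a) n" "b \<in> words (Suc a) (Suc a) M" for u b
      using that by (simp add: list_encode_eq bs)
    have "finite X" unfolding X_def by (intro finite_lists_length_eq) simp
    have "\<exists>b\<in>words (Suc a) (Suc (Suc a)) M. \<forall>u v.
           map (\<lambda>y. c (subst (Suc a) (a # u) b @ subst (Suc a) y f)) us
           = map (\<lambda>y. c (subst (Suc a) (0 # v) b @ subst (Suc a) y f)) us"
      by (rule shelah_block[where c="\<lambda>w. map (\<lambda>y. c (w @ subst (Suc a) y f)) us" and X=X])
        (use c \<open>finite X\<close> in \<open>auto simp: X_def M_def\<close>)
    then obtain b where b: "b \<in> words (Suc a) (Suc (Suc a)) M"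
      and blk: "\<And>u v y. y \<in> words (Suc a) (Suc a) n \<Longrightarrow>
         c (subst (Suc a) (a # u) b @ subst (Suc a) y f) = c (subst (Suc a) (0 # v) b @ subst (Suc a) y f)"
      using us by auto
    let ?f = "b @ shift (Suc a) f"
    have "rigid (Suc (Suc a)) (Suc (Suc a + n)) (shift (Suc a) f)"
      using f by (intro rigid_shift) (auto simp: words_def)
    then have "?f \<in> words (Suc a) (Suc a + Suc n) (M + N)"
      using b f by (auto simp: words_def intro: rigid_append)
    moreover have "c (subst (Suc a) u ?f) = c (subst (Suc a) (merge_last a u) ?f)"
      if "u \<in> words (Suc a) (Suc a) (Suc n)" for u
    proof -
      obtain x v where u: "u = x # v" "x < Suc a" and v: "v \<in> words (Suc a) (Suc a) n"
        using \<open>u \<in> _\<close> by (cases u) (auto simp: words_same)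
      define x' where "x' = (if x = a then 0 else x)"
      have split: "subst (Suc a) (z # y) ?f = subst (Suc a) (z # y) b @ subst (Suc a) y f" for z y
        using subst_shift_Cons[of "Suc a" z y f] by (simp add: subst_def)
      have "subst (Suc a) (x # v) b \<in> words (Suc a) (Suc a) M"
      proof -
        have "[x] \<in> words (Suc a) (Suc a) 1" using u by (auto simp: words_same)
        then have "subst (Suc a) [x] b \<in> words (Suc a) (Suc a) M"
          using b words_subst[of b "Suc a" 1 M "[x]" "Suc a"] by simp
        moreover have "subst (Suc a) (x # v) b = subst (Suc a) [x] b"
          using b rigid_set[of "Suc a" "Suc (Suc a)" b] by (auto simp: words_def subst_def less_Suc_eq)
        ultimately show ?thesis by simp
      qed
      then have "c (subst (Suc a) u ?f) = c (subst (Suc a) (x # v) b @ subst (Suc a) (merge_last a v) f)"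
        using tail[OF v] by (simp add: u split)
      also have "merge_last a v \<in> words (Suc a) (Suc a) n"
        using v by (auto simp: words_same merge_last_def)
      then have "c (subst (Suc a) (x # v) b @ subst (Suc a) (merge_last a v) f)
         = c (subst (Suc a) (x' # merge_last a v) b @ subst (Suc a) (merge_last a v) f)"
      proof (cases "x = a")
        case True
        then show ?thesis using blk[OF \<open>merge_last a v \<in> _\<close>] by (simp add: x'_def)
      next
        case False
        have "subst (Suc a) (x # v) b = subst (Suc a) (x # merge_last a v) b"
          using b rigid_set[of "Suc a" "Suc (Suc a)" b] by (auto simp: words_def subst_def less_Suc_eq)
        then show ?thesis using False by (simp add: x'_def)
      qed
      also have "\<dots> = c (subst (Suc a) (merge_last a u) ?f)"
        using u by (simp add: split merge_last_def x'_def)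
      finally show ?thesis .
    qed
    ultimately show "\<exists>f\<in>words (Suc a) (Suc a + Suc n) (M + N). \<forall>u\<in>words (Suc a) (Suc a) (Suc n).
        c (subst (Suc a) u f) = c (subst (Suc a) (merge_last a u) f)" by blast
  qed
qed

lemma rigid_upt: "rigid a (a + m) [a..<a + m]"
proof (induction m arbitrary: a)
  case (Suc m)
  show ?case using Suc[of "Suc a"] by (simp add: upt_conv_Cons del: upt_Suc)
qed simp

text \<open>Induction on the number of constants. On the word \<open>f\<close> from
  \<open>shelah\<close> the letters \<open>a\<close> and \<open>0\<close> look alike, so the word
  \<open>h\<close> for the smaller alphabet suffices: since \<open>shift a h\<close> does not
  contain \<open>a\<close>, merging after substitution into it is substitution of the merged word
  into \<open>h\<close>.\<close>

lemma Hales_Jewett: "0 < a \<Longrightarrow> GR a a m r"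
proof (induction a rule: nat_induct_non_zero)
  case 1
  have "[1..<1 + m] \<in> words 1 (1 + m) m"
    using rigid_upt[of 1 m] by (simp add: words_def)
  \<comment> \<open>With \<open>0\<close> as the only constant there is just one word to
    substitute.\<close>
  moreover have "g = replicate m 0" if "g \<in> words 1 1 m" for g
    using that by (auto simp: words_same intro: replicate_eqI)
  ultimately show ?case unfolding GR_def by metis
next
  case (Suc a)
  obtain n where n: "\<And>c. (\<forall>w. c w < r) \<Longrightarrow>
     (\<exists>f\<in>words a (a + m) n. \<exists>t. \<forall>g\<in>words a a m. c (subst a g f) = t)"
    using Suc.IH unfolding GR_def by blast
  obtain N where N: "\<And>c. (\<forall>w. c w < (r::nat)) \<Longrightarrow>
     (\<exists>f\<in>words (Suc a) (Suc a + n) N. \<forall>u\<in>words (Suc a) (Suc a) n.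
        c (subst (Suc a) u f) = c (subst (Suc a) (merge_last a u) f))"
    using shelah by blast
  show ?case unfolding GR_def
  proof (intro exI[of _ N] allI impI)
    fix c :: "nat list \<Rightarrow> nat" assume c: "\<forall>w. c w < r"
    obtain f where f: "f \<in> words (Suc a) (Suc a + n) N"
      "\<And>u. u \<in> words (Suc a) (Suc a) n \<Longrightarrow>
        c (subst (Suc a) u f) = c (subst (Suc a) (merge_last a u) f)"
      using N[OF c] by blast
    obtain h t where h: "h \<in> words a (a + m) n"
      "\<And>g. g \<in> words a a m \<Longrightarrow> c (subst (Suc a) (subst a g h) f) = t"
      using n[of "\<lambda>w. c (subst (Suc a) w f)"] c by blast
    have sh: "shift a h \<in> words (Suc a) (Suc a + m) n"
      using words_shift[OF h(1)] by simp
    have "c (subst (Suc a) g (subst (Suc a) (shift a h) f)) = t" if g: "g \<in> words (Suc a) (Suc a) m" for g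
    proof -
      have d: "merge_last a g \<in> words a a m"
        using g \<open>0 < a\<close> by (auto simp: words_same merge_last_def)
      have "c (subst (Suc a) g (subst (Suc a) (shift a h) f)) = c (subst (Suc a) (subst (Suc a) g (shift a h)) f)"
        using words_subst_subst[OF f(1)] sh by (simp add: words_def)
      also have "\<dots> = c (subst (Suc a) (merge_last a (subst (Suc a) g (shift a h))) f)"
        using f(2) words_subst[OF sh g] by simp
      also have "merge_last a (subst (Suc a) g (shift a h)) = subst a (merge_last a g) h"
        using h(1) rigid_set[of a "a + m" h] g
        by (auto simp: merge_last_def subst_def shift_def words_def)
      also have "c (subst (Suc a) \<dots> f) = t" using h(2) d by simp
      finally show ?thesis .
    qed
    moreover have "subst (Suc a) (shift a h) f \<in> words (Suc a) (Suc a + m) N"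
      using words_subst[OF f(1)] sh by simp
    ultimately show "\<exists>f\<in>words (Suc a) (Suc a + m) N. \<exists>t. \<forall>g\<in>words (Suc a) (Suc a) m. c (subst (Suc a) g f) = t"
      by blast
  qed
qed

section \<open>The Graham-Rothschild theorem\<close>

text \<open>
  The part of \<open>subst a (u @ v) f\<close> that depends only on \<open>u\<close>.
\<close>

definition truncate :: "nat \<Rightarrow> nat list \<Rightarrow> nat list \<Rightarrow> nat list" where
  "truncate a u f = subst a u (takeWhile (\<lambda>x. x < a + length u) f)"

lemma truncate_Nil: "truncate a [] f = takeWhile (\<lambda>x. x < a) f"
  by (auto simp: truncate_def subst_def intro!: map_idI dest: set_takeWhileD)

section \<open>Truncation and constant prefixes\<close>

text \<open>The parameters of \<open>h\<close> appear in order, so the first letter of the composite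
  that violates \<open>P\<close> sits where \<open>h\<close> first uses the parameter pointing to
  the first such letter of \<open>F\<close>. The start \<open>j\<close> varies for the induction and
  must not have passed that parameter.\<close>

lemma takeWhile_subst:
  assumes "rigid j (a + length F) h" "j \<le> a + length (takeWhile P F)" "\<And>x. x < a \<Longrightarrow> P x"
  shows "takeWhile (\<lambda>x. P (if x < a then x else F ! (x - a))) h
       = takeWhile (\<lambda>x. x < a + length (takeWhile P F)) h"
  using assms(1,2)
proof (induction h arbitrary: j)
  case (Cons x h)
  let ?L = "length (takeWhile P F)"
  show ?case
  proof (cases "x < a + ?L")
    case True
    have "P (if x < a then x else F ! (x - a))"
    proof (cases "x < a")
      case False
      then have "x - a < ?L" using True by auto
      then have "takeWhile P F ! (x - a) \<in> set (takeWhile P F)" by simp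
      then show ?thesis
        using False set_takeWhileD takeWhile_nth[OF \<open>x - a < ?L\<close>] by fastforce
    qed (use assms(3) in simp)
    moreover have "rigid j (a + length F) h \<and> j \<le> a + ?L \<or> rigid (Suc j) (a + length F) h \<and> Suc j \<le> a + ?L"
      using Cons.prems True by (auto split: if_splits)
    ultimately show ?thesis using True Cons.IH by (auto split del: if_split)
  next
    case False
    then have x: "x = a + ?L" using Cons.prems by (auto split: if_splits)
    then have "?L < length F" using rigid_set[OF Cons.prems(1)] by auto
    then have "\<not> P (F ! ?L)" by (rule nth_length_takeWhile)
    then show ?thesis using x by simp
  qed
qed simp

text \<open>Cutting the composite cuts \<open>h\<close> at the parameter that points to where
  \<open>F\<close> is cut. For empty \<open>u\<close> this computes the constant prefix of a
  composite.\<close>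

lemma truncate_subst:
  assumes "rigid a (a + length F) h"
  shows "truncate a u (subst a F h) = truncate a (truncate a u F) h"
proof -
  let ?P = "\<lambda>x. x < a + length u"
  let ?L = "length (takeWhile ?P F)"
  have L: "length (truncate a u F) = ?L" by (simp add: truncate_def)
  have "takeWhile ?P (subst a F h) = subst a F (takeWhile (\<lambda>x. x < a + ?L) h)"
    using takeWhile_subst[OF assms, of ?P] by (simp add: subst_def takeWhile_map comp_def)
  moreover have "subst a u (subst a F (takeWhile (\<lambda>x. x < a + ?L) h))
      = subst a (truncate a u F) (takeWhile (\<lambda>x. x < a + ?L) h)"
    by (auto simp: subst_def truncate_def takeWhile_nth dest!: set_takeWhileD)
  ultimately show ?thesis by (simp add: truncate_def[of a u "subst a F h"] truncate_def[of a "truncate a u F"] L)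
qed

text \<open>The appended parameter is never below \<open>a + length u\<close>, so the truncation
  stops there at the latest. With \<open>truncate_full\<close>, a \<open>u\<close> of length
  \<open>m\<close> thus yields a complete substitution into \<open>f\<close>.\<close>

lemma truncate_snoc:
  "length u \<le> m \<Longrightarrow> truncate a u (f @ [a + m]) = truncate a u f"
  by (simp add: truncate_def takeWhile_tail)

lemma truncate_full:
  "f \<in> words a (a + length u) n \<Longrightarrow> truncate a u f = subst a u f"
  using rigid_set[of a "a + length u" f]
  by (auto simp: truncate_def words_def subset_iff intro!: arg_cong[where f="subst a u"])

lemma length_takeWhile_words:
  assumes "g \<in> words a k n" "a < k"
  shows "length (takeWhile (\<lambda>x. x < a) g) < n"
proof -
  obtain p where "p < length g" "g ! p = a"
    using assms rigid_first[of a k g a] by (auto simp: words_def)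
  then have "takeWhile (\<lambda>x. x < a) g \<noteq> g"
    by (metis less_irrefl nth_mem takeWhile_eq_all_conv)
  then have "length (takeWhile (\<lambda>x. x < a) g) \<noteq> length g"
    by (metis takeWhile_eq_take take_all_iff le_refl)
  then show ?thesis
    using assms(1) length_takeWhile_le[of "\<lambda>x. x < a" g] by (simp add: words_def)
qed

section \<open>From one parameter fewer to the Graham-Rothschild theorem\<close>

text \<open>Induction on \<open>n\<close>; the new word starts with the parameter \<open>a\<close>.
  If \<open>g\<close> starts with \<open>a\<close> too, that letter counts as one more constant in
  the rest, and the assumption \<open>GR\<close> makes the colour constant. If \<open>g\<close>
  starts with a constant, the induction hypothesis treats the rest, for all \<open>a\<close>
  possible constants at once.\<close>

lemma colour_of_prefix:
  assumes GR: "\<And>m r. GR (Suc a) k m r" and "a < k"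
  shows "\<exists>N. \<forall>c. (\<forall>w. c w < (r::nat)) \<longrightarrow>
     (\<exists>f\<in>words a (a + n) N. \<forall>g\<in>words a k n. \<forall>g'\<in>words a k n.
        takeWhile (\<lambda>x. x < a) g = takeWhile (\<lambda>x. x < a) g' \<longrightarrow> c (subst a g f) = c (subst a g' f))"
proof (induction n arbitrary: r)
  case 0
  have "words a k 0 = {}" using \<open>a < k\<close> by (auto simp: words_def)
  then show ?case by (intro exI[of _ 0] allI impI bexI[of _ "[]"]) (auto simp: words_def)
next
  case (Suc n)
  obtain R where R: "\<And>xs. length xs = a \<Longrightarrow> set xs \<subseteq> {..<r} \<Longrightarrow> list_encode xs < R"
    using list_encode_bound[of a r] by blast
  obtain N2 where N2: "\<And>c. (\<forall>w. c w < R) \<Longrightarrow>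
     (\<exists>f\<in>words a (a + n) N2. \<forall>g\<in>words a k n. \<forall>g'\<in>words a k n.
        takeWhile (\<lambda>x. x < a) g = takeWhile (\<lambda>x. x < a) g' \<longrightarrow> c (subst a g f) = c (subst a g' f))"
    using Suc.IH[of R] by blast
  obtain N1 where N1: "\<And>c. (\<forall>w. c w < r) \<Longrightarrow>
     (\<exists>f\<in>words (Suc a) (Suc a + N2) N1. \<exists>t. \<forall>g\<in>words (Suc a) k N2. c (subst (Suc a) g f) = t)"
    using GR[of N2 r] unfolding GR_def by blast
  show ?case
  proof (intro exI[of _ "Suc N1"] allI impI)
    fix c :: "nat list \<Rightarrow> nat" assume c: "\<forall>w. c w < r"
    obtain h t where h: "h \<in> words (Suc a) (Suc a + N2) N1"
      and ht: "\<And>g. g \<in> words (Suc a) k N2 \<Longrightarrow> c (a # subst (Suc a) g h) = t"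
      using N1[of "\<lambda>w. c (a # w)"] c by blast
    \<comment> \<open>The colour vector over all constant first letters \<open>x\<close>; the
      constant \<open>a\<close> of \<open>h\<close> is the first parameter of the new word and
      becomes \<open>x\<close>.\<close>
    have "\<forall>w. list_encode (map (\<lambda>x. c (x # subst a (x # w) h)) [0..<a]) < R"
      using c by (auto intro!: R)
    from N2[OF this] obtain f where f: "f \<in> words a (a + n) N2"
      and *: "\<And>g g'. g\<in>words a k n \<Longrightarrow> g'\<in>words a k n \<Longrightarrow>
        takeWhile (\<lambda>x. x < a) g = takeWhile (\<lambda>x. x < a) g' \<Longrightarrow>
        list_encode (map (\<lambda>x. c (x # subst a (x # subst a g f) h)) [0..<a])
        = list_encode (map (\<lambda>x. c (x # subst a (x # subst a g' f) h)) [0..<a])"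
      by blast
    have ft: "c (x # subst a (x # subst a g f) h) = c (x # subst a (x # subst a g' f) h)"
      if "g\<in>words a k n" "g'\<in>words a k n" "x < a"
        "takeWhile (\<lambda>x. x < a) g = takeWhile (\<lambda>x. x < a) g'" for g g' x
      using *[OF that(1,2,4)] that(3) by (simp add: list_encode_eq)
    let ?F = "a # subst (Suc a) (shift a f) h"
    have sh: "shift a f \<in> words (Suc a) (Suc a + n) N2" using words_shift[OF f] by simp
    have "subst (Suc a) (shift a f) h \<in> words (Suc a) (Suc a + n) N1"
      by (rule words_subst[OF h sh])
    then have F: "?F \<in> words a (a + Suc n) (Suc N1)" by (simp add: words_def)
    have h_less: "y < Suc a + N2" if "y \<in> set h" for y
      using h that rigid_set[of "Suc a" "Suc a + N2" h] by (auto simp: words_def)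
    have len: "length f = N2" using f by (simp add: words_def)
    have sub_less: "subst a (x # g) ?F = x # subst a (x # subst a g f) h" if "x < a" for x g
      using that h_less len by (fastforce simp: subst_def shift_def nth_Cons' Suc_diff_le)
    have sub_eq: "subst a (a # g) ?F = a # subst (Suc a) (subst (Suc a) g (shift a f)) h" for g
      using h_less len by (fastforce simp: subst_def shift_def nth_Cons' Suc_diff_le)
    have "c (subst a g ?F) = c (subst a g' ?F)"
      if g: "g \<in> words a k (Suc n)" and g': "g' \<in> words a k (Suc n)"
        and eq: "takeWhile (\<lambda>x. x < a) g = takeWhile (\<lambda>x. x < a) g'" for g g'
    proof -
      obtain x v x' v' where gs: "g = x # v" "g' = x' # v'"
        using g g' by (cases g; cases g') (auto simp: words_def)
      show ?thesis
      proof (cases "x < a")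
        case True
        then have x: "x' = x" "x' < a" using eq gs by (auto split: if_splits)
        then have v: "v \<in> words a k n" "v' \<in> words a k n" "takeWhile (\<lambda>x. x < a) v = takeWhile (\<lambda>x. x < a) v'"
          using g g' eq gs True by (auto simp: words_def)
        show ?thesis
          using ft[OF v(1,2) True v(3)] True by (simp only: gs x(1) sub_less)
      next
        case False
        then have x': "\<not> x' < a" using eq gs by (auto split: if_splits)
        then have x: "x = a" "x' = a" "v \<in> words (Suc a) k n" "v' \<in> words (Suc a) k n"
          using False g g' gs by (auto simp: words_def)
        have "subst (Suc a) v (shift a f) \<in> words (Suc a) k N2" "subst (Suc a) v' (shift a f) \<in> words (Suc a) k N2"
          using words_subst[OF sh] x by auto
        then show ?thesis by (simp only: gs x(1,2) sub_eq ht)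
      qed
    qed
    with F show "\<exists>f\<in>words a (a + Suc n) (Suc N1). \<forall>g\<in>words a k (Suc n). \<forall>g'\<in>words a k (Suc n).
        takeWhile (\<lambda>x. x < a) g = takeWhile (\<lambda>x. x < a) g' \<longrightarrow> c (subst a g f) = c (subst a g' f)"
      by blast
  qed
qed

text \<open>Induction on \<open>m\<close>, appending a parameter to allow the length
  \<open>m\<close>. A \<open>u\<close> of that length leads to a complete substitution into
  \<open>h\<close>, where Hales-Jewett fixes the colour. Shorter ones are covered by the previous
  word, taken for the colouring of truncations of \<open>H\<close>.\<close>

lemma colour_of_length:
  assumes "0 < a"
  shows "\<exists>N. \<forall>c. (\<forall>w. c w < (r::nat)) \<longrightarrow>
     (\<exists>f\<in>words a (a + m) N. \<exists>\<phi>. \<forall>u. set u \<subseteq> {..<a} \<and> length u < m \<longrightarrow> c (truncate a u f) = \<phi> (length u))"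
proof (induction m)
  case 0
  show ?case by (intro exI[of _ 0] allI impI bexI[of _ "[]"]) (auto simp: words_def)
next
  case (Suc m)
  then obtain n where n: "\<And>c. (\<forall>w. c w < r) \<Longrightarrow>
     (\<exists>f\<in>words a (a + m) n. \<exists>\<phi>. \<forall>u. set u \<subseteq> {..<a} \<and> length u < m \<longrightarrow> c (truncate a u f) = \<phi> (length u))"
    by blast
  obtain N where N: "\<And>c. (\<forall>w. c w < r) \<Longrightarrow>
     (\<exists>f\<in>words a (a + n) N. \<exists>t. \<forall>g\<in>words a a n. c (subst a g f) = t)"
    using Hales_Jewett[OF assms, of n r] unfolding GR_def by blast
  show ?case
  proof (intro exI[of _ "Suc N"] allI impI)
    fix c :: "nat list \<Rightarrow> nat" assume c: "\<forall>w. c w < r"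
    obtain h t where h: "h \<in> words a (a + n) N"
      and ht: "\<And>g. g \<in> words a a n \<Longrightarrow> c (subst a g h) = t"
      using N[OF c] by blast
    define H where "H = h @ [a + n]"
    obtain f \<phi> where f: "f \<in> words a (a + m) n"
      and f\<phi>: "\<And>u. set u \<subseteq> {..<a} \<Longrightarrow> length u < m \<Longrightarrow> c (truncate a (truncate a u f) H) = \<phi> (length u)"
      using n[of "\<lambda>w. c (truncate a w H)"] c by blast
    have snoc: "v @ [a + l] \<in> words a (a + Suc l) (Suc q)" if "v \<in> words a (a + l) q" for v l q
      using that rigid_append[of a "a + l" v "Suc (a + l)" "[a + l]"] by (auto simp: words_def)
    have H: "H \<in> words a (a + Suc n) (Suc N)" using snoc[OF h] by (simp add: H_def)
    have F: "f @ [a + m] \<in> words a (a + Suc m) (Suc n)" by (rule snoc[OF f])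
    have "c (truncate a u (subst a (f @ [a + m]) H)) = (\<phi>(m := t)) (length u)"
      if u: "set u \<subseteq> {..<a}" "length u < Suc m" for u
    proof -
      have "truncate a u (subst a (f @ [a + m]) H) = truncate a (truncate a u (f @ [a + m])) H"
        using H F by (intro truncate_subst) (simp add: words_def)
      also have "\<dots> = truncate a (truncate a u f) H"
        using u by (simp add: truncate_snoc)
      finally have eq: "truncate a u (subst a (f @ [a + m]) H) = truncate a (truncate a u f) H" .
      show ?thesis
      proof (cases "length u = m")
        case True
        then have uf: "truncate a u f = subst a u f" using f truncate_full by blast
        have "u \<in> words a a m" using u True by (simp add: words_same)
        then have w: "subst a u f \<in> words a a n" by (rule words_subst[OF f])
        then have "length (subst a u f) = n" by (simp add: words_def)
        then have "truncate a (subst a u f) H = subst a (subst a u f) h"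
          using h unfolding H_def by (simp only: truncate_snoc truncate_full)
        then show ?thesis using eq uf ht[OF w] True by simp
      next
        case False
        then show ?thesis using eq f\<phi> u by simp
      qed
    qed
    with words_subst[OF H F]
    show "\<exists>f\<in>words a (a + Suc m) (Suc N). \<exists>\<phi>. \<forall>u. set u \<subseteq> {..<a} \<and> length u < Suc m \<longrightarrow> c (truncate a u f) = \<phi> (length u)"
      by blast
  qed
qed

text \<open>Each position in \<open>I\<close> gets a parameter of its own, all others the constant
  \<open>0\<close>.\<close>

lemma ex_word_parameters_in:
  assumes "0 < a"
  shows "\<exists>s\<in>words a (a + card (I \<inter> {..<n})) n. \<forall>i<n. a \<le> s ! i \<longrightarrow> i \<in> I"
proof (induction n)
  case 0
  show ?case by (auto simp: words_def)
next
  case (Suc n)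
  let ?d = "card (I \<inter> {..<n})"
  obtain s where s: "s \<in> words a (a + ?d) n" "\<forall>i<n. a \<le> s ! i \<longrightarrow> i \<in> I"
    using Suc.IH by blast
  have len: "length s = n" using s by (simp add: words_def)
  have I: "I \<inter> {..<Suc n} = (if n \<in> I then insert n (I \<inter> {..<n}) else I \<inter> {..<n})"
    by (auto simp: less_Suc_eq)
  define x where "x = (if n \<in> I then a + ?d else 0)"
  have "rigid (a + ?d) (a + card (I \<inter> {..<Suc n})) [x]"
    using assms by (auto simp: I x_def)
  then have "s @ [x] \<in> words a (a + card (I \<inter> {..<Suc n})) (Suc n)"
    using s rigid_append by (auto simp: words_def)
  moreover have "\<forall>i<Suc n. a \<le> (s @ [x]) ! i \<longrightarrow> i \<in> I"
    using s assms len by (auto simp: nth_append x_def less_Suc_eq)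
  ultimately show ?case by blast
qed

lemma pigeonhole_card:
  assumes "\<And>i. i < r * m \<Longrightarrow> \<phi> i < (r::nat)" "0 < r"
  shows "\<exists>t<r. m \<le> card {i. i < r * m \<and> \<phi> i = t}"
proof (rule ccontr)
  assume "\<not> ?thesis"
  then have less: "card {i. i < r * m \<and> \<phi> i = t} < m" if "t < r" for t
    using that by auto
  have "{..<r * m} = (\<Union>t\<in>{..<r}. {i. i < r * m \<and> \<phi> i = t})" using assms by auto
  then have "r * m \<le> (\<Sum>t<r. card {i. i < r * m \<and> \<phi> i = t})"
    by (metis card_UN_le card_lessThan finite_lessThan)
  also have "\<dots> < (\<Sum>t<r. m)"
    using assms(2) less by (intro sum_strict_mono) auto
  finally show False by simp
qed

text \<open>Three nested words: inside \<open>f1\<close> the colour depends only on the constant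
  prefix, inside \<open>f2\<close> only on the length of that prefix, and \<open>f3\<close> confines
  this length to a set \<open>I\<close> on which the colour is the same, found by pigeonhole among
  \<open>r * m\<close> lengths.\<close>

lemma GR_step:
  assumes GR: "\<And>m r. GR (Suc a) k m r" and "a < k" "0 < a"
  shows "GR a k m r"
proof -
  obtain n where n: "\<And>c. (\<forall>w. c w < r) \<Longrightarrow>
     (\<exists>f\<in>words a (a + r * m) n. \<exists>\<phi>. \<forall>u. set u \<subseteq> {..<a} \<and> length u < r * m \<longrightarrow> c (truncate a u f) = \<phi> (length u))"
    using colour_of_length[OF \<open>0 < a\<close>, of r "r * m"] by blast
  obtain N where N: "\<And>c. (\<forall>w. c w < r) \<Longrightarrow>
     (\<exists>f\<in>words a (a + n) N. \<forall>g\<in>words a k n. \<forall>g'\<in>words a k n.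
        takeWhile (\<lambda>x. x < a) g = takeWhile (\<lambda>x. x < a) g' \<longrightarrow> c (subst a g f) = c (subst a g' f))"
    using colour_of_prefix[OF GR \<open>a < k\<close>, of r n] by blast
  show ?thesis unfolding GR_def
  proof (intro exI[of _ N] allI impI)
    fix c :: "nat list \<Rightarrow> nat" assume c: "\<forall>w. c w < r"
    then have "0 < r" using gr_zeroI by fastforce
    obtain f1 where f1: "f1 \<in> words a (a + n) N"
      and f1c: "\<And>g g'. g\<in>words a k n \<Longrightarrow> g'\<in>words a k n \<Longrightarrow>
        takeWhile (\<lambda>x. x < a) g = takeWhile (\<lambda>x. x < a) g' \<Longrightarrow> c (subst a g f1) = c (subst a g' f1)"
      using N[OF c] by blast
    \<comment> \<open>Any word with prefix \<open>u\<close> may represent it. If there is none, the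
      value is still a colour below \<open>r\<close>, as a total colouring requires.\<close>
    define \<psi> where "\<psi> u = c (subst a (SOME g. g \<in> words a k n \<and> takeWhile (\<lambda>x. x < a) g = u) f1)" for u
    have \<psi>: "c (subst a g f1) = \<psi> (takeWhile (\<lambda>x. x < a) g)" if "g \<in> words a k n" for g
    proof -
      have "\<exists>g'. g' \<in> words a k n \<and> takeWhile (\<lambda>x. x < a) g' = takeWhile (\<lambda>x. x < a) g"
        using that by blast
      from someI_ex[OF this] show ?thesis using f1c that unfolding \<psi>_def by metis
    qed
    obtain f2 \<phi> where f2: "f2 \<in> words a (a + r * m) n"
      and \<phi>: "\<And>u. set u \<subseteq> {..<a} \<Longrightarrow> length u < r * m \<Longrightarrow> \<psi> (truncate a u f2) = \<phi> (length u)"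
      using n[of \<psi>] c unfolding \<psi>_def by blast
    have "\<phi> i < r" if "i < r * m" for i
      using \<phi>[of "replicate i 0"] that c \<open>0 < a\<close> unfolding \<psi>_def
      by (metis length_replicate lessThan_iff set_replicate_conv_if empty_subsetI insert_subset)
    then obtain t where t: "m \<le> card {i. i < r * m \<and> \<phi> i = t}"
      using pigeonhole_card[of r m \<phi>] \<open>0 < r\<close> by blast
    then obtain I where I: "I \<subseteq> {i. i < r * m \<and> \<phi> i = t}" "card I = m"
      by (meson obtain_subset_with_card_n)
    have "I \<inter> {..<r * m} = I" using I by auto
    then obtain f3 where f3: "f3 \<in> words a (a + m) (r * m)"
      and f3I: "\<forall>i<r * m. a \<le> f3 ! i \<longrightarrow> i \<in> I"
      using ex_word_parameters_in[OF \<open>0 < a\<close>, of I "r * m"] I(2) by auto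
    have f23: "subst a f3 f2 \<in> words a (a + m) n" by (rule words_subst[OF f2 f3])
    have "c (subst a g (subst a (subst a f3 f2) f1)) = t" if g: "g \<in> words a k m" for g
    proof -
      define G where "G = subst a g f3"
      define p where "p = takeWhile (\<lambda>x. x < a) G"
      have G: "G \<in> words a k (r * m)" unfolding G_def by (rule words_subst[OF f3 g])
      have len: "length p < r * m" unfolding p_def by (rule length_takeWhile_words[OF G \<open>a < k\<close>])
      have lenG: "length G = r * m" using G by (simp add: words_def)
      have "\<not> G ! length p < a"
        unfolding p_def using nth_length_takeWhile[of "\<lambda>x. x < a" G] len lenG by (simp add: p_def)
      \<comment> \<open>Constants of \<open>f3\<close> survive in \<open>G\<close>, so the first
        parameter of \<open>G\<close> comes from a parameter of \<open>f3\<close>.\<close>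
      then have "a \<le> f3 ! length p" using len lenG by (auto simp: G_def subst_def split: if_splits)
      then have pt: "\<phi> (length p) = t" using f3I I len by auto
      have "subst a g (subst a (subst a f3 f2) f1) = subst a (subst a g (subst a f3 f2)) f1"
        using words_subst_subst[OF f1] f23 by (simp add: words_def)
      also have "subst a g (subst a f3 f2) = subst a G f2"
        using words_subst_subst[OF f2] f3 by (simp add: words_def G_def)
      also have "c (subst a (subst a G f2) f1) = \<psi> (takeWhile (\<lambda>x. x < a) (subst a G f2))"
        by (rule \<psi>[OF words_subst[OF f2 G]])
      also have "takeWhile (\<lambda>x. x < a) (subst a G f2) = truncate a p f2"
        using truncate_subst[of a G f2 "[]"] f2 lenG by (simp add: truncate_Nil p_def words_def)
      also have "\<psi> \<dots> = t"
        using \<phi>[of p] len pt by (auto simp: p_def dest: set_takeWhileD)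
      finally show ?thesis .
    qed
    with words_subst[OF f1 f23]
    show "\<exists>f\<in>words a (a + m) N. \<exists>t. \<forall>g\<in>words a k m. c (subst a g f) = t" by blast
  qed
qed

text \<open>Induction on the number \<open>k - a\<close> of parameters with \<open>k\<close> fixed:
  each parameter removed becomes a constant, which leads to Hales-Jewett over \<open>k\<close>
  constants.\<close>

lemma Graham_Rothschild: "0 < a \<Longrightarrow> a \<le> k \<Longrightarrow> GR a k m r"
proof (induction "k - a" arbitrary: a m r)
  case 0
  then show ?case using Hales_Jewett by simp
next
  case (Suc d)
  show ?case
  proof (rule GR_step)
    show "GR (Suc a) k m r" for m r using Suc.hyps Suc.prems by auto
  qed (use Suc in auto)
qed

section \<open>Ordered polyhedra and nerves\<close>

definition simplices :: "'a ordered_L_structure \<Rightarrow> 'a set set" where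
  "simplices M = {s. \<exists>xs. xs \<in> rel M (length xs) \<and> set xs = s}"

definition embedding ::
  "'a ordered_L_structure \<Rightarrow> 'b ordered_L_structure \<Rightarrow> ('a \<Rightarrow> 'b) \<Rightarrow> bool" where
  "embedding M N e \<longleftrightarrow>
     inj_on e (univ M) \<and> e ` univ M \<subseteq> univ N \<and>
     (\<forall>s \<subseteq> univ M. s \<in> simplices M \<longleftrightarrow> e ` s \<in> simplices N) \<and>
     (\<forall>x \<in> univ M. \<forall>y \<in> univ M. (x, y) \<in> less_rel M \<longleftrightarrow> (e x, e y) \<in> less_rel N)"

definition induced :: "'a ordered_L_structure \<Rightarrow> 'a set \<Rightarrow> 'a ordered_L_structure" where
  "induced N U = \<lparr>univ = U, rel = (\<lambda>i. {xs \<in> rel N i. set xs \<subseteq> U}), less_rel = less_rel N \<inter> (U \<times> U)\<rparr>"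

lemma relD:
  assumes "ordered_polyhedron M" "xs \<in> rel M i"
  shows "length xs = i" "distinct xs" "xs \<noteq> []" "set xs \<subseteq> univ M"
proof -
  have L: "is_L_structure M" and "\<forall>i. \<forall>xs \<in> rel M i. distinct xs"
    using assms(1) by (auto simp: ordered_polyhedron_def polyhedron_def)
  then show "distinct xs" using assms(2) by blast
  have "xs \<in> {xs. length xs = i \<and> set xs \<subseteq> univ M}"
    using L assms(2) unfolding is_L_structure_def by blast
  then show "length xs = i" "set xs \<subseteq> univ M" by auto
  have "rel M 0 = {}" using L by (simp add: is_L_structure_def)
  then show "xs \<noteq> []" using assms(2) \<open>length xs = i\<close> by auto
qed

lemma rel_hereditary:
  assumes "ordered_polyhedron M" "xs \<in> rel M i" "ys \<noteq> []" "distinct ys" "set ys \<subseteq> set xs"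
  shows "ys \<in> rel M (length ys)"
proof -
  have "\<forall>i k xs ys. xs \<in> rel M i \<and> 1 \<le> k \<and> k \<le> i \<and>
        length ys = k \<and> distinct ys \<and> set ys \<subseteq> set xs \<longrightarrow> ys \<in> rel M k"
    using assms(1) unfolding ordered_polyhedron_def polyhedron_def by (elim conjE)
  moreover have "length ys \<le> i"
    using card_mono[OF _ assms(5)] distinct_card[OF assms(4)] card_length[of xs] relD(1)[OF assms(1,2)]
    by simp
  moreover have "1 \<le> length ys" using assms(3) by (simp add: Suc_le_eq)
  ultimately show ?thesis using assms by blast
qed

text \<open>The relations carry the same information as the family of simplices, so later arguments
  use sets instead of tuples. Reordering a tuple is the case of equal sets in
  \<open>rel_hereditary\<close>.\<close>

lemma rel_iff:
  assumes "ordered_polyhedron M"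
  shows "xs \<in> rel M i \<longleftrightarrow> length xs = i \<and> distinct xs \<and> set xs \<in> simplices M"
proof
  assume "xs \<in> rel M i"
  then show "length xs = i \<and> distinct xs \<and> set xs \<in> simplices M"
    using relD[OF assms] by (auto simp: simplices_def)
next
  assume *: "length xs = i \<and> distinct xs \<and> set xs \<in> simplices M"
  then obtain ys where ys: "ys \<in> rel M (length ys)" "set ys = set xs"
    unfolding simplices_def by blast
  then have "xs \<noteq> []" using relD(3)[OF assms ys(1)] by auto
  then show "xs \<in> rel M i" using rel_hereditary[OF assms ys(1)] * ys(2) by auto
qed

lemma simplicesD:
  assumes "ordered_polyhedron M" "s \<in> simplices M"
  shows "finite s" "s \<noteq> {}" "s \<subseteq> univ M"
proof -
  obtain xs where "xs \<in> rel M (length xs)" "set xs = s"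
    using assms(2) unfolding simplices_def by blast
  then show "finite s" "s \<noteq> {}" "s \<subseteq> univ M"
    using relD(3,4)[OF assms(1), of xs] by auto
qed

lemma simplices_subset:
  assumes "ordered_polyhedron M" "s \<in> simplices M" "t \<subseteq> s" "t \<noteq> {}"
  shows "t \<in> simplices M"
proof -
  obtain xs where xs: "xs \<in> rel M (length xs)" "set xs = s"
    using assms(2) unfolding simplices_def by blast
  then obtain ys where "distinct ys" "set ys = t"
    using finite_distinct_list[of t] finite_subset[OF assms(3)] by auto
  then have "ys \<in> rel M (length ys)"
    using rel_hereditary[OF assms(1) xs(1)] xs(2) assms(3,4) by auto
  then show ?thesis using \<open>set ys = t\<close> unfolding simplices_def by blast
qed

lemma singleton_simplex:
  assumes "ordered_polyhedron M" "x \<in> univ M"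
  shows "{x} \<in> simplices M"
proof -
  have "[x] \<in> rel M (length [x])"
    using assms unfolding ordered_polyhedron_def polyhedron_def by auto
  then show ?thesis unfolding simplices_def by (intro CollectI exI[of _ "[x]"]) simp
qed

lemma less_rel_total:
  assumes "ordered_polyhedron M" "x \<in> univ M" "y \<in> univ M"
  shows "x = y \<or> (x, y) \<in> less_rel M \<or> (y, x) \<in> less_rel M"
  using assms unfolding ordered_polyhedron_def total_on_def by blast

lemma less_rel_irrefl: "ordered_polyhedron M \<Longrightarrow> (x, x) \<notin> less_rel M"
  unfolding ordered_polyhedron_def irrefl_def by blast

lemma less_rel_trans:
  "ordered_polyhedron M \<Longrightarrow> (x, y) \<in> less_rel M \<Longrightarrow> (y, z) \<in> less_rel M \<Longrightarrow> (x, z) \<in> less_rel M"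
  unfolding ordered_polyhedron_def by (meson transD)

lemma substructure_induced: "U \<subseteq> univ N \<Longrightarrow> substructure (induced N U) N"
  by (simp add: substructure_def induced_def)

lemma substructure_eq_induced: "substructure M N \<Longrightarrow> M = induced N (univ M)"
  by (auto simp: substructure_def induced_def intro!: ordered_L_structure.equality ext)

lemma substructure_trans: "substructure L M \<Longrightarrow> substructure M N \<Longrightarrow> substructure L N"
  unfolding substructure_def by auto

text \<open>The inverse of an isomorphism from a copy onto \<open>M\<close> is an embedding of
  \<open>M\<close>, and conversely.\<close>

lemma copies_eq:
  assumes M: "ordered_polyhedron M" and N: "ordered_polyhedron N"
  shows "copies N M = {induced N (e ` univ M) |e. embedding M N e}"
proof (intro set_eqI iffI)
  fix K assume "K \<in> {induced N (e ` univ M) |e. embedding M N e}"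
  then obtain e where K: "K = induced N (e ` univ M)" and e: "embedding M N e" by blast
  let ?f = "inv_into (univ M) e"
  have inj: "inj_on e (univ M)" using e by (simp add: embedding_def)
  have fin: "?f y \<in> univ M" "e (?f y) = y" if "y \<in> e ` univ M" for y
    using that by (auto intro: inv_into_into f_inv_into_f)
  have "bij_betw ?f (univ K) (univ M)"
    using inj by (simp add: K induced_def bij_betw_inv_into inj_on_imp_bij_betw)
  moreover have "xs \<in> rel K i \<longleftrightarrow> map ?f xs \<in> rel M i" if "length xs = i" "set xs \<subseteq> univ K" for xs i
  proof -
    have xs: "set xs \<subseteq> e ` univ M" using that by (simp add: K induced_def)
    have "?f ` set xs \<subseteq> univ M" using xs fin by auto
    moreover have "e ` ?f ` set xs = set xs"
      using xs by (simp add: image_f_inv_f image_inv_into_cancel)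
    ultimately have "set xs \<in> simplices N \<longleftrightarrow> ?f ` set xs \<in> simplices M"
      using e unfolding embedding_def by metis
    moreover have "distinct (map ?f xs) \<longleftrightarrow> distinct xs"
      using inj_on_inv_into[OF xs] by (simp add: distinct_map)
    moreover have "xs \<in> rel K i \<longleftrightarrow> xs \<in> rel N i" using xs by (simp add: K induced_def)
    ultimately show ?thesis by (simp add: rel_iff[OF M] rel_iff[OF N])
  qed
  moreover have "(x, y) \<in> less_rel K \<longleftrightarrow> (?f x, ?f y) \<in> less_rel M" if "x \<in> univ K" "y \<in> univ K" for x y
    using that e fin[of x] fin[of y] unfolding embedding_def K induced_def by auto
  ultimately have "isomorphic K M" unfolding isomorphic_def by blast
  then show "K \<in> copies N M"
    using e by (simp add: copies_def K substructure_induced embedding_def)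
next
  fix K assume "K \<in> copies N M"
  then obtain f where sub: "substructure K N" and bij: "bij_betw f (univ K) (univ M)"
    and rel: "\<And>i xs. length xs = i \<Longrightarrow> set xs \<subseteq> univ K \<Longrightarrow> xs \<in> rel K i \<longleftrightarrow> map f xs \<in> rel M i"
    and less: "\<And>x y. x \<in> univ K \<Longrightarrow> y \<in> univ K \<Longrightarrow> (x, y) \<in> less_rel K \<longleftrightarrow> (f x, f y) \<in> less_rel M"
    unfolding copies_def isomorphic_def by blast
  let ?e = "inv_into (univ K) f"
  have bij': "bij_betw ?e (univ M) (univ K)" using bij by (rule bij_betw_inv_into)
  have fe: "f (?e x) = x" if "x \<in> univ M" for x
    using bij that by (rule bij_betw_inv_into_right)
  have eK: "?e x \<in> univ K" if "x \<in> univ M" for x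
    using bij' that by (rule bij_betwE[rule_format])
  have KN: "univ K \<subseteq> univ N" using sub by (simp add: substructure_def)
  have "s \<in> simplices M \<longleftrightarrow> ?e ` s \<in> simplices N" if s: "s \<subseteq> univ M" for s
  proof -
    have inj: "inj_on ?e s" using bij' s by (meson bij_betw_imp_inj_on inj_on_subset)
    show ?thesis
    proof (cases "finite s")
      case True
      then obtain xs where xs: "set xs = s" "distinct xs" using finite_distinct_list by blast
      have "map f (map ?e xs) = xs" using xs s fe by (auto intro!: map_idI)
      moreover have "set (map ?e xs) \<subseteq> univ K" using xs s eK by auto
      ultimately have "xs \<in> rel M (length xs) \<longleftrightarrow> map ?e xs \<in> rel K (length xs)"
        using rel[of "map ?e xs" "length xs"] by simp
      also have "\<dots> \<longleftrightarrow> map ?e xs \<in> rel N (length xs)"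
        using sub \<open>set (map ?e xs) \<subseteq> univ K\<close> by (auto simp: substructure_def)
      finally show ?thesis
        using xs inj by (simp add: rel_iff[OF M] rel_iff[OF N] distinct_map)
    next
      case False
      \<comment> \<open>For infinite \<open>s\<close> neither side holds, since simplices are finite
        and \<open>?e\<close> is injective on \<open>s\<close>.\<close>
      then show ?thesis
        using inj simplicesD(1)[OF M] simplicesD(1)[OF N] finite_image_iff by blast
    qed
  qed
  moreover have "(x, y) \<in> less_rel M \<longleftrightarrow> (?e x, ?e y) \<in> less_rel N" if "x \<in> univ M" "y \<in> univ M" for x y
    using less[OF eK[OF that(1)] eK[OF that(2)]] fe that eK sub by (auto simp: substructure_def)
  ultimately have "embedding M N ?e"
    using bij' KN unfolding embedding_def bij_betw_def by blast
  moreover have "K = induced N (?e ` univ M)"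
    using substructure_eq_induced[OF sub] bij' by (simp add: bij_betw_def)
  ultimately show "K \<in> {induced N (e ` univ M) |e. embedding M N e}" by blast
qed

text \<open>The map \<open>e\<close> is \<open>\<theta>\<close> followed by the inverse of
  \<open>w\<close>; simplices and order are compared inside \<open>C\<close>.\<close>

lemma embedding_factor:
  assumes "embedding A C \<theta>" "embedding B C w" "\<theta> ` univ A \<subseteq> w ` univ B"
  obtains e where "embedding A B e" "\<And>x. x \<in> univ A \<Longrightarrow> w (e x) = \<theta> x"
proof -
  define e where "e x = inv_into (univ B) w (\<theta> x)" for x
  have we: "w (e x) = \<theta> x" and eB: "e x \<in> univ B" if "x \<in> univ A" for x
    using subsetD[OF assms(3) imageI[OF that]] unfolding e_def by (auto intro: f_inv_into_f inv_into_into)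
  have "inj_on e (univ A)"
    using assms(1) we unfolding embedding_def inj_on_def by metis
  moreover have "s \<in> simplices A \<longleftrightarrow> e ` s \<in> simplices B" if s: "s \<subseteq> univ A" for s
  proof -
    have "w ` e ` s = \<theta> ` s" using s we by (force simp: image_image)
    moreover have "e ` s \<subseteq> univ B" using s eB by auto
    ultimately show ?thesis using assms(1,2) s unfolding embedding_def by metis
  qed
  moreover have "(x, y) \<in> less_rel A \<longleftrightarrow> (e x, e y) \<in> less_rel B" if "x \<in> univ A" "y \<in> univ A" for x y
    using assms(1,2) that we eB unfolding embedding_def by metis
  ultimately have "embedding A B e" using eB unfolding embedding_def by blast
  then show thesis using we that by blast
qed

section \<open>Colexicographic enumeration of faces\<close>

text \<open>Comparison of binary numbers: the highest digit where they differ decides, as all powers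
  of two below \<open>2 ^ m\<close> sum to less than \<open>2 ^ m\<close>.\<close>

lemma set_encode_less_iff:
  assumes "finite S" "finite T"
  shows "set_encode S < set_encode T \<longleftrightarrow> (\<exists>m\<in>T - S. \<forall>x\<in>S - T. x < m)"
proof -
  have less: "set_encode S < set_encode T"
    if fin: "finite S" "finite T" and m: "m \<in> T - S" "\<forall>x\<in>S - T. x < m" for S T m
  proof -
    have split: "set_encode X = sum ((^) 2) (X \<inter> Y) + sum ((^) 2) (X - Y)" if "finite X" for X Y
      using that by (simp add: set_encode_def sum.Int_Diff)
    have "sum ((^) 2) (S - T) \<le> sum ((^) (2::nat)) {..<m}"
      using m fin by (intro sum_mono2) auto
    also have "\<dots> < (2::nat) ^ m"
      using sum_power2[of m] by (simp add: atLeast0LessThan)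
    also have "\<dots> \<le> sum ((^) 2) (T - S)"
      using m fin by (intro member_le_sum) auto
    finally show ?thesis using split[OF fin(1), of T] split[OF fin(2), of S] by (simp add: Int_commute)
  qed
  show ?thesis
  proof
    assume lt: "set_encode S < set_encode T"
    let ?D = "(S - T) \<union> (T - S)"
    have "?D \<noteq> {}" "finite ?D" using lt assms by auto
    then have D: "Max ?D \<in> ?D" "\<And>x. x \<in> ?D \<Longrightarrow> x \<le> Max ?D" by (rule Max_in[rotated], auto)
    have "\<not> Max ?D \<in> S - T"
    proof
      assume mS: "Max ?D \<in> S - T"
      have "x < Max ?D" if "x \<in> T - S" for x
        using D(2)[of x] that mS by (metis DiffD1 DiffD2 UnI2 order_le_less)
      then show False using less[OF assms(2,1) mS] lt by auto
    qed
    then have mT: "Max ?D \<in> T - S" using D(1) by blast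
    have "x < Max ?D" if "x \<in> S - T" for x
      using D(2)[of x] that mT by (metis DiffD1 DiffD2 UnI1 order_le_less)
    with mT show "\<exists>m\<in>T - S. \<forall>x\<in>S - T. x < m" by blast
  qed (use less assms in blast)
qed

text \<open>The colexicographic order: for finite sets in a total order, the largest element of the
  symmetric difference lies in \<open>t\<close>.\<close>

definition colex :: "'a ordered_L_structure \<Rightarrow> 'a set \<Rightarrow> 'a set \<Rightarrow> bool" where
  "colex M s t \<longleftrightarrow> (\<exists>y\<in>t - s. \<forall>x\<in>s - t. (x, y) \<in> less_rel M)"

definition faces :: "'a ordered_L_structure \<Rightarrow> 'a set set" where
  "faces M = insert {} (simplices M)"

definition enumeration :: "'a ordered_L_structure \<Rightarrow> (nat \<Rightarrow> 'a set) \<Rightarrow> bool" where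
  "enumeration M E \<longleftrightarrow> bij_betw E {..<card (faces M)} (faces M) \<and>
     (\<forall>i<card (faces M). \<forall>j<card (faces M). i < j \<longleftrightarrow> colex M (E i) (E j))"

lemma rank_exists:
  assumes "M \<in> KP"
  shows "\<exists>\<rho>::'a \<Rightarrow> nat. \<forall>x\<in>univ M. \<forall>y\<in>univ M. (x, y) \<in> less_rel M \<longleftrightarrow> \<rho> x < \<rho> y"
proof -
  have M: "ordered_polyhedron M" "finite (univ M)" using assms by (auto simp: KP_def)
  have sub: "less_rel M \<subseteq> univ M \<times> univ M" using M by (simp add: ordered_polyhedron_def)
  define \<rho> where "\<rho> x = card {z. (z, x) \<in> less_rel M}" for x
  have fin: "finite {z. (z, x) \<in> less_rel M}" for x
    using M(2) sub by (rule_tac finite_subset[of _ "univ M"]) auto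
  have mono: "\<rho> x < \<rho> y" if "(x, y) \<in> less_rel M" for x y
    unfolding \<rho>_def
    using that less_rel_irrefl[OF M(1), of x] less_rel_trans[OF M(1)] by (intro psubset_card_mono fin) blast
  have "(x, y) \<in> less_rel M" if "x \<in> univ M" "y \<in> univ M" "\<rho> x < \<rho> y" for x y
    using less_rel_total[OF M(1) that(1,2)] that(3) mono[of y x] by auto
  with mono show ?thesis by blast
qed

lemma finite_faces: "M \<in> KP \<Longrightarrow> finite (faces M)"
  unfolding faces_def KP_def
  by (auto intro!: finite_subset[of "simplices M" "Pow (univ M)"] dest: simplicesD(3))

lemma face_subset: "M \<in> KP \<Longrightarrow> s \<in> faces M \<Longrightarrow> s \<subseteq> univ M"
  unfolding faces_def KP_def by (auto dest: simplicesD(3))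

text \<open>Ranking the vertices turns faces into finite sets of naturals, whose codes are ordered
  as the faces are by \<open>colex\<close>; \<open>h\<close> lists these codes increasingly.\<close>

lemma enumeration_exists:
  assumes "M \<in> KP"
  shows "\<exists>E. enumeration M E"
proof -
  obtain \<rho> :: "'a \<Rightarrow> nat" where \<rho>: "\<And>x y. x \<in> univ M \<Longrightarrow> y \<in> univ M \<Longrightarrow> (x, y) \<in> less_rel M \<longleftrightarrow> \<rho> x < \<rho> y"
    using rank_exists[OF assms] by blast
  have M: "ordered_polyhedron M" "finite (univ M)" using assms by (auto simp: KP_def)
  have inj\<rho>: "inj_on \<rho> (univ M)"
    using less_rel_total[OF M(1)] \<rho> by (metis inj_onI less_irrefl)
  define key where "key s = set_encode (\<rho> ` s)" for s
  have fin: "finite s" if "s \<subseteq> univ M" for s using that M finite_subset by blast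
  have key: "key s < key t \<longleftrightarrow> colex M s t" if st: "s \<subseteq> univ M" "t \<subseteq> univ M" for s t
  proof -
    have diff: "\<rho> ` t - \<rho> ` s = \<rho> ` (t - s)" "\<rho> ` s - \<rho> ` t = \<rho> ` (s - t)"
      using inj_on_image_set_diff[OF inj\<rho>] st by (metis Diff_subset order_trans)+
    have "key s < key t \<longleftrightarrow> (\<exists>y\<in>t - s. \<forall>x\<in>s - t. \<rho> x < \<rho> y)"
      unfolding key_def using fin st by (simp add: set_encode_less_iff diff)
    then show ?thesis unfolding colex_def using \<rho> st by blast
  qed
  have inj: "inj_on key (faces M)"
  proof (rule inj_onI)
    fix s t assume "s \<in> faces M" "t \<in> faces M" and eq: "key s = key t"
    then have st: "s \<subseteq> univ M" "t \<subseteq> univ M" using face_subset[OF assms] by auto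
    then have "\<rho> ` s = \<rho> ` t" using eq fin unfolding key_def by (simp add: set_encode_eq)
    then show "s = t" using inj_on_image_eq_iff[OF inj\<rho>] st by blast
  qed
  obtain h where h: "bij_betw h {..<card (key ` faces M)} (key ` faces M)"
    "strict_mono_on {..<card (key ` faces M)} h"
    using ex_bij_betw_strict_mono_card[of "key ` faces M"] finite_faces[OF assms] by blast
  have card: "card (key ` faces M) = card (faces M)" using inj by (rule card_image)
  define E where "E = inv_into (faces M) key \<circ> h"
  have bij: "bij_betw E {..<card (faces M)} (faces M)"
    unfolding E_def using h(1) bij_betw_inv_into[OF inj_on_imp_bij_betw[OF inj]]
    unfolding card by (rule bij_betw_trans)
  have keyE: "key (E i) = h i" if "i < card (faces M)" for i
    using that h(1) unfolding E_def card by (auto simp: bij_betw_def intro!: f_inv_into_f)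
  have "i < j \<longleftrightarrow> colex M (E i) (E j)" if "i < card (faces M)" "j < card (faces M)" for i j
  proof -
    have "E i \<subseteq> univ M" "E j \<subseteq> univ M"
      using bij that face_subset[OF assms] by (auto simp: bij_betw_def)
    then have "colex M (E i) (E j) \<longleftrightarrow> h i < h j" using key keyE that by metis
    also have "\<dots> \<longleftrightarrow> i < j"
      using h(2) that unfolding card by (simp add: strict_mono_on_less)
    finally show ?thesis by simp
  qed
  with bij show ?thesis unfolding enumeration_def by blast
qed

lemma card_faces_pos: "M \<in> KP \<Longrightarrow> 0 < card (faces M)"
  using finite_faces[of M] by (auto simp: faces_def card_gt_0_iff)

context
  fixes M :: "'a ordered_L_structure" and E
  assumes E: "enumeration M E"
begin

lemma enumeration_face: "i < card (faces M) \<Longrightarrow> E i \<in> faces M"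
  using E by (auto simp: enumeration_def bij_betw_def)

lemma enumeration_onto:
  assumes "s \<in> faces M" obtains i where "i < card (faces M)" "E i = s"
proof -
  have "s \<in> E ` {..<card (faces M)}" using E assms by (simp add: enumeration_def bij_betw_def)
  then show thesis using that by blast
qed

text \<open>\<open>colex\<close> extends proper inclusion, as no element is left to be
  dominated.\<close>

lemma enumeration_mono:
  assumes "i < card (faces M)" "j < card (faces M)" "E i \<subseteq> E j"
  shows "i \<le> j"
proof (cases "E i = E j")
  case True
  then show ?thesis using E assms by (auto simp: enumeration_def bij_betw_def inj_on_def)
next
  case False
  then have "colex M (E i) (E j)" using assms(3) by (auto simp: colex_def)
  then have "i < j" using E assms(1,2) unfolding enumeration_def by blast
  then show ?thesis by simp
qed

lemma enumeration_0:
  assumes "M \<in> KP"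
  shows "E 0 = {}"
proof -
  obtain i where i: "i < card (faces M)" "E i = {}"
    using enumeration_onto[of "{}"] by (auto simp: faces_def)
  then have "i \<le> 0" by (intro enumeration_mono card_faces_pos assms) auto
  with i show ?thesis by simp
qed

text \<open>The vertex \<open>b\<close> witnesses \<open>colex\<close>, since only \<open>a\<close>
  can be missing from \<open>E j\<close>. This will make first occurrences follow the order of the
  vertices.\<close>

lemma enumeration_vertex_less:
  assumes M: "M \<in> KP" and ab: "(a, b) \<in> less_rel M"
    and "E i = {a}" "b \<in> E j" "i < card (faces M)" "j < card (faces M)"
  shows "i < j"
proof -
  have "a \<noteq> b" using ab M less_rel_irrefl[of M a] by (auto simp: KP_def)
  then have "colex M (E i) (E j)" using assms by (auto simp: colex_def)
  then show ?thesis using E assms(5,6) unfolding enumeration_def by blast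
qed

end

section \<open>The nerve and embeddings given by parameter words\<close>

text \<open>Coding subsets as numbers keeps the structure on \<open>nat\<close>. The order is
  reversed because position \<open>p\<close> will be stored as \<open>N - Suc p\<close>, so that an
  earlier first position means a larger code.\<close>

definition nerve :: "nat \<Rightarrow> nat ordered_L_structure" where
  "nerve N = (let V = set_encode ` (Pow {..<N} - {{}}) in
     \<lparr>univ = V,
      rel = (\<lambda>i. {xs. length xs = i \<and> distinct xs \<and> xs \<noteq> [] \<and> set xs \<subseteq> V \<and>
                   (\<exists>p. \<forall>x\<in>set xs. p \<in> set_decode x)}),
      less_rel = {(x, y). x \<in> V \<and> y \<in> V \<and> y < x}\<rparr>)"

lemma univ_nerve: "univ (nerve N) = set_encode ` (Pow {..<N} - {{}})"
  by (simp add: nerve_def Let_def)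

lemma less_rel_nerve: "(x, y) \<in> less_rel (nerve N) \<longleftrightarrow> x \<in> univ (nerve N) \<and> y \<in> univ (nerve N) \<and> y < x"
  by (simp add: nerve_def Let_def)

lemma rel_nerve:
  "xs \<in> rel (nerve N) i \<longleftrightarrow> length xs = i \<and> distinct xs \<and> xs \<noteq> [] \<and> set xs \<subseteq> univ (nerve N) \<and>
     (\<exists>p. \<forall>x\<in>set xs. p \<in> set_decode x)"
  by (simp add: nerve_def Let_def)

lemma nerve_KP: "nerve N \<in> KP"
proof -
  have fin: "finite (univ (nerve N))" by (simp add: univ_nerve)
  have ne: "\<exists>p. p \<in> set_decode x" if "x \<in> univ (nerve N)" for x
    using that by (auto simp: univ_nerve finite_subset)
  have perm: "permute_list \<sigma> xs = [] \<longleftrightarrow> xs = []" for \<sigma> and xs :: "nat list"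
    by (metis length_0_conv length_permute_list)
  have "polyhedron (nerve N)"
    unfolding polyhedron_def is_L_structure_def
  proof (intro conjI allI impI)
    fix i k and xs ys :: "nat list"
    assume "xs \<in> rel (nerve N) i \<and> 1 \<le> k \<and> k \<le> i \<and> length ys = k \<and> distinct ys \<and> set ys \<subseteq> set xs"
    then show "ys \<in> rel (nerve N) k" unfolding rel_nerve by fastforce
  qed (use fin ne in \<open>auto simp: rel_nerve countable_finite perm\<close>)
  moreover have "irrefl (less_rel (nerve N)) \<and> trans (less_rel (nerve N)) \<and> total_on (univ (nerve N)) (less_rel (nerve N))"
    by (auto simp: irrefl_def trans_def total_on_def less_rel_nerve)
  moreover have "less_rel (nerve N) \<subseteq> univ (nerve N) \<times> univ (nerve N)" by (auto simp: less_rel_nerve)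
  ultimately show ?thesis using fin by (simp add: KP_def ordered_polyhedron_def)
qed

lemma simplices_nerve:
  "s \<in> simplices (nerve N) \<longleftrightarrow> s \<noteq> {} \<and> s \<subseteq> univ (nerve N) \<and> (\<exists>p. \<forall>x\<in>s. p \<in> set_decode x)"
proof
  assume "s \<noteq> {} \<and> s \<subseteq> univ (nerve N) \<and> (\<exists>p. \<forall>x\<in>s. p \<in> set_decode x)"
  moreover have "finite (univ (nerve N))" by (simp add: univ_nerve)
  moreover obtain xs where "set xs = s" "distinct xs"
    using finite_distinct_list[of s] finite_subset calculation by blast
  ultimately have "set xs = s" "xs \<in> rel (nerve N) (length xs)" by (auto simp: rel_nerve)
  then show "s \<in> simplices (nerve N)" unfolding simplices_def by blast
qed (auto simp: simplices_def rel_nerve)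

text \<open>
  Positions are counted from the end because \<^const>\<open>set_encode\<close> compares sets by their largest
  elements, whereas the letters of a parameter word are ordered by their first occurrences.
\<close>

definition vertex :: "(nat \<Rightarrow> 'a set) \<Rightarrow> nat list \<Rightarrow> 'a \<Rightarrow> nat" where
  "vertex E h a = set_encode ((\<lambda>p. length h - Suc p) ` {p. p < length h \<and> a \<in> E (h ! p)})"

lemma set_decode_vertex:
  "set_decode (vertex E h a) = (\<lambda>p. length h - Suc p) ` {p. p < length h \<and> a \<in> E (h ! p)}"
  by (simp add: vertex_def)

text \<open>A simplex occurs as a letter, and the position of that letter is common to its vertices.
  Conversely, the letter at a common position is a face that contains all the given
  vertices.\<close>

lemma embedding_vertex:
  assumes E: "enumeration M E" and M: "M \<in> KP" and h: "h \<in> words 1 (card (faces M)) N"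
  shows "embedding M (nerve N) (vertex E h)"
proof -
  have poly: "ordered_polyhedron M" using M by (simp add: KP_def)
  have len: "length h = N" using h by (simp add: words_def)
  have letter: "h ! p < card (faces M)" if "p < N" for p
    using h that rigid_set[of 1 "card (faces M)" h] by (auto simp: words_def subset_iff)
  have occurs: "\<exists>i p. i < card (faces M) \<and> E i = s \<and> p < N \<and> h ! p = i \<and> (\<forall>q<p. h ! q < i)"
    if s: "s \<in> simplices M" for s
  proof -
    obtain i where i: "i < card (faces M)" "E i = s"
      using enumeration_onto[OF E] s unfolding faces_def by blast
    \<comment> \<open>Only \<open>0\<close>, the empty face, is a constant; every other face is a
      parameter and must occur.\<close>
    have "i \<noteq> 0" using i enumeration_0[OF E M] simplicesD(2)[OF poly s] by auto
    then obtain p where "p < length h" "h ! p = i" "\<forall>q<p. h ! q < i"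
      using rigid_first[of 1 "card (faces M)" h i] h i by (auto simp: words_def)
    then show ?thesis using i len by blast
  qed
  have vertex_univ: "vertex E h a \<in> univ (nerve N)" if a: "a \<in> univ M" for a
  proof -
    obtain p where "p < N" "E (h ! p) = {a}"
      using occurs[OF singleton_simplex[OF poly a]] by blast
    then show ?thesis unfolding vertex_def univ_nerve len by (intro imageI) auto
  qed
  have decreasing: "vertex E h b < vertex E h a" if ab: "(a, b) \<in> less_rel M" for a b
  proof -
    have "a \<in> univ M" using ab poly by (auto simp: ordered_polyhedron_def)
    then obtain i p where p: "i < card (faces M)" "E i = {a}" "p < N" "h ! p = i" "\<forall>q<p. h ! q < i"
      using occurs[OF singleton_simplex[OF poly]] by blast
    \<comment> \<open>Letters before the first \<open>{a}\<close> have smaller numbers than it,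
      letters containing \<open>b\<close> larger ones.\<close>
    have later: "p < q" if "q < N" "b \<in> E (h ! q)" for q
    proof -
      have "i < h ! q" using enumeration_vertex_less[OF E M ab p(2) that(2) p(1) letter[OF that(1)]] .
      then show ?thesis using p(4,5) by (metis less_asym less_irrefl linorder_neqE_nat)
    qed
    let ?S = "\<lambda>a. (\<lambda>p. N - Suc p) ` {p. p < N \<and> a \<in> E (h ! p)}"
    have "x < N - Suc p" if "x \<in> ?S b" for x using that later p(3) by force
    moreover have "N - Suc p \<in> ?S a" using p by auto
    ultimately have "set_encode (?S b) < set_encode (?S a)"
      by (subst set_encode_less_iff) (auto intro!: bexI[of _ "N - Suc p"])
    then show ?thesis by (simp add: vertex_def len)
  qed
  have "inj_on (vertex E h) (univ M)"
    using less_rel_total[OF poly] decreasing by (metis inj_onI less_irrefl)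
  moreover have "s \<in> simplices M \<longleftrightarrow> vertex E h ` s \<in> simplices (nerve N)" if s: "s \<subseteq> univ M" for s
  proof
    assume sM: "s \<in> simplices M"
    then obtain p where p: "p < N" "E (h ! p) = s" using occurs by blast
    then have "\<forall>x\<in>vertex E h ` s. N - Suc p \<in> set_decode x"
      by (auto simp: set_decode_vertex len)
    then show "vertex E h ` s \<in> simplices (nerve N)"
      using simplicesD(2)[OF poly sM] s vertex_univ unfolding simplices_nerve by blast
  next
    assume "vertex E h ` s \<in> simplices (nerve N)"
    then obtain q where "s \<noteq> {}" and q: "\<And>x. x \<in> s \<Longrightarrow> q \<in> set_decode (vertex E h x)"
      unfolding simplices_nerve by blast
    have inE: "N - Suc q < N \<and> x \<in> E (h ! (N - Suc q))" if "x \<in> s" for x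
    proof -
      obtain p where "q = N - Suc p" "p < N" "x \<in> E (h ! p)"
        using q[OF \<open>x \<in> s\<close>] by (auto simp: set_decode_vertex len)
      moreover from this have "N - Suc q = p" by simp
      ultimately show ?thesis by simp
    qed
    then have "E (h ! (N - Suc q)) \<in> faces M" "s \<subseteq> E (h ! (N - Suc q))"
      using \<open>s \<noteq> {}\<close> letter enumeration_face[OF E] by blast+
    then show "s \<in> simplices M"
      using \<open>s \<noteq> {}\<close> simplices_subset[OF poly] unfolding faces_def by blast
  qed
  moreover have "(x, y) \<in> less_rel M \<longleftrightarrow> (vertex E h x, vertex E h y) \<in> less_rel (nerve N)"
    if "x \<in> univ M" "y \<in> univ M" for x y
    using less_rel_total[OF poly that] decreasing[of x y] decreasing[of y x] vertex_univ that less_rel_irrefl[OF poly]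
    by (auto simp: less_rel_nerve)
  ultimately show ?thesis using vertex_univ unfolding embedding_def by blast
qed

section \<open>Embeddings as substitutions\<close>

lemma colex_embedding:
  assumes "embedding A B e" "s \<subseteq> univ A" "t \<subseteq> univ A"
  shows "colex B (e ` s) (e ` t) \<longleftrightarrow> colex A s t"
proof -
  have inj: "inj_on e (univ A)" using assms(1) by (simp add: embedding_def)
  have "e ` t - e ` s = e ` (t - s)" "e ` s - e ` t = e ` (s - t)"
    using inj_on_image_set_diff[OF inj] assms(2,3) by (metis Diff_subset order_trans)+
  then have "colex B (e ` s) (e ` t) \<longleftrightarrow> (\<exists>y\<in>t - s. \<forall>x\<in>s - t. (e x, e y) \<in> less_rel B)"
    by (simp add: colex_def)
  also have "(e x, e y) \<in> less_rel B \<longleftrightarrow> (x, y) \<in> less_rel A" if "x \<in> s" "y \<in> t" for x y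
    using assms that unfolding embedding_def by (metis subsetD)
  then have "(\<exists>y\<in>t - s. \<forall>x\<in>s - t. (e x, e y) \<in> less_rel B) \<longleftrightarrow> (\<exists>y\<in>t - s. \<forall>x\<in>s - t. (x, y) \<in> less_rel A)"
    by (intro bex_cong ball_cong refl) simp
  finally show ?thesis by (simp add: colex_def)
qed

text \<open>Each face of \<open>B\<close> is replaced by its preimage under \<open>e\<close>. The
  letter \<open>i\<close> first arises from the image of \<open>EA i\<close>, with number
  \<open>j\<close>: if some \<open>q < j\<close> had \<open>G q\<close> at least \<open>i\<close>,
  the image of \<open>trace q\<close> would have a number at least \<open>j\<close>, but it lies
  inside \<open>EB q\<close> and so has a number at most \<open>q\<close>.\<close>

lemma word_of_embedding:
  assumes EA: "enumeration A EA" and A: "A \<in> KP" and EB: "enumeration B EB" and B: "B \<in> KP"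
    and e: "embedding A B e"
  obtains g where "g \<in> words 1 (card (faces A)) (card (faces B) - 1)"
    and "\<And>f a. f \<in> words 1 (card (faces B)) N \<Longrightarrow> a \<in> univ A \<Longrightarrow>
      vertex EA (subst 1 g f) a = vertex EB f (e a)"
proof -
  let ?k = "card (faces A)" and ?l = "card (faces B)"
  have polyA: "ordered_polyhedron A" and polyB: "ordered_polyhedron B" using A B by (auto simp: KP_def)
  have inj: "inj_on e (univ A)" using e by (simp add: embedding_def)
  define trace where "trace j = {a \<in> univ A. e a \<in> EB j}" for j
  define G where "G j = inv_into {..<?k} EA (trace j)" for j
  have trace: "trace j \<in> faces A" if "j < ?l" for j
  proof (cases "trace j = {}")
    case False
    have "e ` trace j \<subseteq> EB j" "e ` trace j \<noteq> {}" using False by (auto simp: trace_def)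
    moreover have "EB j \<in> faces B" by (rule enumeration_face[OF EB that])
    ultimately have "e ` trace j \<in> simplices B"
      using simplices_subset[OF polyB, of "EB j"] unfolding faces_def by blast
    moreover have "trace j \<subseteq> univ A" by (auto simp: trace_def)
    ultimately show ?thesis using e unfolding embedding_def faces_def by blast
  qed (simp add: faces_def)
  have G: "G j < ?k" "EA (G j) = trace j" if "j < ?l" for j
    using EA trace[OF that] unfolding G_def enumeration_def bij_betw_def
    by (metis inv_into_into lessThan_iff, metis f_inv_into_f)
  have GI: "G j = i" if "EA i = trace j" "i < ?k" for i j
    using EA that unfolding G_def enumeration_def bij_betw_def by (metis inv_into_f_f lessThan_iff)
  have G0: "G 0 = 0"
    using enumeration_0[OF EA A] enumeration_0[OF EB B] card_faces_pos[OF A] by (intro GI) (simp_all add: trace_def)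
  \<comment> \<open>Face number \<open>j\<close> sits at position \<open>j - 1\<close>; number
    \<open>0\<close> is left out because substitution fixes the constant \<open>0\<close>, in
    accordance with \<open>G0\<close>.\<close>
  define g where "g = map G [1..<?l]"
  have len: "length g = ?l - 1" by (simp add: g_def)
  have "rigid 1 ?k g"
  proof (rule rigidI)
    show "1 \<le> ?k" using card_faces_pos[OF A] by simp
    show "set g \<subseteq> {..<?k}" using G by (auto simp: g_def)
    fix i assume i: "1 \<le> i" "i < ?k"
    have iA: "EA i \<subseteq> univ A" using enumeration_face[OF EA i(2)] face_subset[OF A] by blast
    have "EA i \<noteq> {}"
      using enumeration_0[OF EA A] EA i unfolding enumeration_def bij_betw_def inj_on_def
      by (metis card_faces_pos[OF A] lessThan_iff not_one_le_zero)
    then have "EA i \<in> simplices A" using enumeration_face[OF EA i(2)] by (auto simp: faces_def)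
    then have "e ` EA i \<in> faces B" using e iA unfolding embedding_def faces_def by blast
    then obtain j where j: "j < ?l" "EB j = e ` EA i" by (rule enumeration_onto[OF EB])
    have "j \<noteq> 0" using j enumeration_0[OF EB B] \<open>EA i \<noteq> {}\<close> by auto
    have "trace j = EA i" using inj iA unfolding trace_def j(2) by (auto simp: inj_on_def)
    then have "G j = i" using GI i by simp
    moreover have "G q < i" if q: "q < j" for q
    proof (rule ccontr)
      have ql: "q < ?l" using q j by simp
      assume "\<not> G q < i"
      have tA: "trace q \<subseteq> univ A" by (auto simp: trace_def)
      have sub: "e ` trace q \<subseteq> EB q" by (auto simp: trace_def)
      have "e ` trace q \<in> faces B" using e trace[OF ql] tA unfolding embedding_def faces_def by auto
      then obtain q' where q': "q' < ?l" "EB q' = e ` trace q" by (rule enumeration_onto[OF EB])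
      have "q' \<le> q" using enumeration_mono[OF EB q'(1) ql] q' sub by simp
      moreover have "j \<le> q'"
      proof (cases "G q = i")
        case True
        then have "EB q' = EB j" using G(2)[OF ql] q' j by simp
        then show ?thesis using enumeration_mono[OF EB j(1) q'(1)] by simp
      next
        case False
        then have "colex A (EA i) (EA (G q))"
          using \<open>\<not> G q < i\<close> EA i(2) G(1)[OF ql] unfolding enumeration_def by (metis linorder_neqE_nat)
        then have "colex B (EB j) (EB q')"
          using colex_embedding[OF e iA tA] G(2)[OF ql] j q' by simp
        then have "j < q'" using EB j(1) q'(1) unfolding enumeration_def by blast
        then show ?thesis by simp
      qed
      ultimately show False using q by simp
    qed
    ultimately show "\<exists>p<length g. g ! p = i \<and> (\<forall>q<p. g ! q < i)"
      using j \<open>j \<noteq> 0\<close> len by (intro exI[of _ "j - 1"]) (auto simp: g_def)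
  qed
  then have "g \<in> words 1 ?k (?l - 1)" using len by (simp add: words_def)
  moreover have "vertex EA (subst 1 g f) a = vertex EB f (e a)"
    if f: "f \<in> words 1 ?l N" and a: "a \<in> univ A" for f a
  proof -
    have letter: "f ! p < ?l" if "p < length f" for p
      using f that rigid_set[of 1 ?l f] by (auto simp: words_def subset_iff)
    have "subst 1 g f ! p = G (f ! p)" if "p < length f" for p
      using that letter[OF that] G0 by (auto simp: subst_def g_def)
    then have "a \<in> EA (subst 1 g f ! p) \<longleftrightarrow> e a \<in> EB (f ! p)" if "p < length f" for p
      using that letter[OF that] G(2) a by (simp add: trace_def)
    then have "{p. p < length f \<and> a \<in> EA (subst 1 g f ! p)} = {p. p < length f \<and> e a \<in> EB (f ! p)}"
      by blast
    then show ?thesis by (simp add: vertex_def)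
  qed
  ultimately show thesis using that by blast
qed

section \<open>The Ramsey property\<close>

theorem theorem4p3p2:
  fixes r :: nat and A B :: "'a ordered_L_structure"
  assumes "r > 1" and "A \<in> KP" and "B \<in> KP" and "substructure A B"
  shows "\<exists>C :: nat ordered_L_structure. C \<in> KP \<and>
           (\<forall>c. c \<in> copies C A \<rightarrow> {..<r} \<longrightarrow>
              (\<exists>B' \<in> copies C B. monochromatic c (copies B' A)))"
proof -
  note A = \<open>A \<in> KP\<close> and B = \<open>B \<in> KP\<close>
  obtain EA EB where EA: "enumeration A EA" and EB: "enumeration B EB"
    using enumeration_exists A B by blast
  let ?k = "card (faces A)" and ?l = "card (faces B)"
  \<comment> \<open>One constant for the empty face; the remaining faces of \<open>B\<close> are the
    parameters.\<close>
  have l: "1 + (?l - 1) = ?l" using card_faces_pos[OF B] by simp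
  have "GR 1 ?k (?l - 1) r"
    using card_faces_pos[OF A] by (intro Graham_Rothschild) auto
  then obtain N where N: "\<And>c. (\<forall>w. c w < r) \<Longrightarrow>
      \<exists>f\<in>words 1 ?l N. \<exists>t. \<forall>g\<in>words 1 ?k (?l - 1). c (subst 1 g f) = t"
    unfolding GR_def l by blast
  have poly: "ordered_polyhedron A" "ordered_polyhedron B" "ordered_polyhedron (nerve N)"
    using A B nerve_KP by (auto simp: KP_def)
  show ?thesis
  proof (intro exI[of _ "nerve N"] conjI allI impI nerve_KP)
    fix c assume c: "c \<in> copies (nerve N) A \<rightarrow> {..<r}"
    let ?copy = "\<lambda>h. induced (nerve N) (vertex EA h ` univ A)"
    \<comment> \<open>\<open>c\<close> is bounded only on copies of \<open>A\<close>, whereas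
      \<open>N\<close> asks for a colouring of all lists; \<open>0\<close> is a valid default
      colour.\<close>
    define c' where "c' h = (if h \<in> words 1 ?k N then c (?copy h) else 0)" for h
    have "c' h < r" for h
    proof (cases "h \<in> words 1 ?k N")
      case True
      then have "?copy h \<in> copies (nerve N) A"
        using embedding_vertex[OF EA A] by (auto simp: copies_eq poly)
      then show ?thesis using c True by (auto simp: c'_def)
    qed (use \<open>r > 1\<close> in \<open>simp add: c'_def\<close>)
    then obtain f t where f: "f \<in> words 1 ?l N"
      and t: "\<And>g. g \<in> words 1 ?k (?l - 1) \<Longrightarrow> c' (subst 1 g f) = t"
      using N[of c'] by blast
    have embB: "embedding B (nerve N) (vertex EB f)" by (rule embedding_vertex[OF EB B f])
    define B' where "B' = induced (nerve N) (vertex EB f ` univ B)"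
    have B': "B' \<in> copies (nerve N) B" using embB by (auto simp: copies_eq poly B'_def)
    have "c A' = t" if A': "A' \<in> copies B' A" for A'
    proof -
      have "substructure A' B'" "isomorphic A' A" using A' by (auto simp: copies_def)
      moreover have "substructure B' (nerve N)" using B' by (simp add: copies_def)
      ultimately have "A' \<in> copies (nerve N) A"
        unfolding copies_def using substructure_trans by blast
      then obtain \<theta> where \<theta>: "embedding A (nerve N) \<theta>" "A' = induced (nerve N) (\<theta> ` univ A)"
        by (auto simp: copies_eq poly)
      have "\<theta> ` univ A \<subseteq> vertex EB f ` univ B"
        using \<open>substructure A' B'\<close> by (simp add: substructure_def \<theta>(2) B'_def induced_def)
      \<comment> \<open>An arbitrary embedding of \<open>A\<close> into the nerve need not come from
        a parameter word, but one with image inside \<open>B'\<close> factors through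
        \<open>B\<close>, and \<open>e\<close> does give a word.\<close>
      then obtain e where e: "embedding A B e" "\<And>x. x \<in> univ A \<Longrightarrow> vertex EB f (e x) = \<theta> x"
        using embedding_factor[OF \<theta>(1) embB] by blast
      obtain g where g: "g \<in> words 1 ?k (?l - 1)"
        "\<And>f a. f \<in> words 1 ?l N \<Longrightarrow> a \<in> univ A \<Longrightarrow> vertex EA (subst 1 g f) a = vertex EB f (e a)"
        using word_of_embedding[OF EA A EB B e(1)] by blast
      have "vertex EA (subst 1 g f) ` univ A = \<theta> ` univ A"
        using g(2)[OF f] e(2) by simp
      then have "c A' = c (?copy (subst 1 g f))" by (simp add: \<theta>(2))
      also have "\<dots> = c' (subst 1 g f)"
        using words_subst[of f 1 "?l - 1" N g ?k] f g(1) by (simp only: l c'_def if_True)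
      also have "\<dots> = t" by (rule t[OF g(1)])
      finally show ?thesis .
    qed
    then have "monochromatic c (copies B' A)" unfolding monochromatic_def by blast
    with B' show "\<exists>B'\<in>copies (nerve N) B. monochromatic c (copies B' A)" by blast
  qed
qed

end
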